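(* Consider the quadratic parametric Darcy operator $\mathcal Av=-\nabla_x\cdot(\kappa_{\rm quad}\nabla_xv)$ and the TT ansatz of the context. Let $k_s=r_{s-1}r_s$, $a_s=\overline{\alpha_{s-1}\alpha_s}$, $\mathsf M_{a_s}=\mathrm e_{\alpha_{s-1}}\mathrm e_{\alpha_s}^\top\in\mathbb R^{r_{s-1}\times r_s}$, and for $\ell\in\Lambda_s$ define $\mathsf P_{s,\ell,a_s}\in\mathbb R^{2\varrho_{s-1}r_{s-1}\times2\varrho_sr_s}$ by $$\mathsf P_{s,0,a_s}=\begin{bmatrix}C_s\otimes\mathsf M_{a_s}&0\\0&C_s\otimes\mathsf M_{a_s}\end{bmatrix},\quad \mathsf P_{s,1,a_s}=\begin{bmatrix}0&-C_s'\otimes\mathsf M_{a_s}\\0&0\end{bmatrix},\quad \mathsf P_{s,2,a_s}=\begin{bmatrix}0&-C_s\otimes\mathsf M_{a_s}\\0&0\end{bmatrix}.$$ Then the local-channel direction matrices $\Psi_{s,\ell,\mathrm{quad}}^{\mathrm{ch}}\in\mathbb R^{N_{\mathcal D}\times n_sk_s}$ are given by $$\Psi_{s,\ell,\mathrm{quad}}^{\mathrm{ch}}(i,\overline{j_sa_s})=\delta_{i_sj_s}\,\mathcal Q_{<s}(z_{<s,i_{<s}})\,\mathsf P_{s,\ell,a_s}(z_{s,j_s})\,\mathcal Q_{>s}(z_{>s,i_{>s}}).$$ Collecting the channels as $\Psi_{s,\mathrm{quad}}^{\mathrm{ch}}:=[\Psi_{s,0,\mathrm{quad}}^{\mathrm{ch}}\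 \Psi_{s,1,\mathrm{quad}}^{\mathrm{ch}}\ \Psi_{s,2,\mathrm{quad}}^{\mathrm{ch}}]$ for $s\le d_x$ and $\Psi_{s,\mathrm{quad}}^{\mathrm{ch}}:=\Psi_{s,0,\mathrm{quad}}^{\mathrm{ch}}$ for $s>d_x$, these are the direction factors of the local-channel factorization $\mathrm J_s=\Psi_{s,\mathrm{quad}}^{\mathrm{ch}}\mathsf C_s^{\mathrm{ch}}$ of the collocated Jacobian blocks. Consequently, the effective compressed dimension (the total number of columns of $\Psi_{1,\mathrm{quad}}^{\mathrm{ch}},\dots,\Psi_{d,\mathrm{quad}}^{\mathrm{ch}}$) is $$N_{\mathrm{eff}}^{\mathrm{ch}}=3\sum_{s=1}^{d_x}n_sr_{s-1}r_s+\sum_{s=d_x+1}^dn_sr_{s-1}r_s.$$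
   Context: $\Omega=(0,1)^{d_x}$, $\Xi=(-1,1)^{d_\xi}$, $d=d_x+d_\xi$, $z=(x,\xi)$, $\mathcal D=\prod_m\mathcal D_m$. Coefficient: with $\varepsilon=0.5$ and $w_j=j^{-2}/\sum_{k=1}^{d_\xi}k^{-2}$, $$\kappa_{\rm quad}(x,\xi)=\Big(1+\varepsilon\,\psi(x)\sum_{j=1}^{d_\xi}w_j\xi_j\Big)^2,\qquad \psi(x)=\prod_{m=1}^{d_x}\cos(\pi x_m).$$ Expanding the square gives a finite separable expansion $\kappa_{\rm quad}=\sum_\tau\prod_{m=1}^d\kappa_{\tau,m}(z_m)$ with $1+2d_\xi+\binom{d_\xi}2$ terms (the terms $1$, $2\varepsilon w_j\psi\xi_j$, $\varepsilon^2w_j^2\psi^2\xi_j^2$, and $2\varepsilon^2w_jw_k\psi^2\xi_j\xi_k$ for $j<k$). Coefficient TT cores: $\chi_m(x_m)=\cos(\pi x_m)$, $\sigma_j(\xi_j)=w_j\xi_j$, $K_m=\operatorname{diag}(1,\chi_m,\chi_m^2)$, $M_j=\begin{bmatrix}1&0&0\\ \sigma_j&1&0\\ \sigma_j^2&2\sigma_j&1\end{bmatrix}$, $\ell_\kappa=[1\ \ 2\varepsilon\ \ \varepsilon^2]$, $r_\kappa=[1\ 0\ 0]^\top$; $\varrho_0=\varrho_d=1$, $\varrho_m=3$ for $1\le m<d$; $C_1=\ell_\kappa K_1$, $C_m=K_m$ for $2\le m\le d_x$, $C_{d_x+j}=M_j(\xi_j)$ for $1\le j<d_\xi$, $C_d=M_{d_\xi}r_\kappa$.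 One has $\kappa_{\rm quad}=C_1(z_1)\cdots C_d(z_d)$. Univariate spaces: $H_s$ are Hilbert spaces with $\partial_{z_s}^\ell:H_s\to L^2(\mathcal D_s)$ bounded for $\ell\le2$ if $s\le d_x$, $\ell=0$ if $s>d_x$, and $H_1\otimes\cdots\otimes H_d$ continuously and densely embedded in $U=L^2(\Xi;V)$, with $\mathcal A:U\to L^2(\mathcal D)$ bounded. TT ansatz: $u_\theta(z)=G_1(z_1;\theta^1)\cdots G_d(z_d;\theta^d)$, $G_m$ valued in $\mathbb R^{r_{m-1}\times r_m}$ with entries in $H_m$, $r_0=r_d=1$, $\theta^m\in\mathbb R^{P_m}$; the parametrizations $\theta^s\mapsto G_s$ are differentiable with values in $C^2(\overline{\mathcal D_s})$ entrywise for $s\le d_x$ and $C(\overline{\mathcal D_s})$ entrywise otherwise. Block cores: $A_m=C_m\otimes G_m$; $B_m=-C_m'\otimes G_m'-C_m\otimes G_m''$ for $m\le d_x$, $B_m=0$ for $m>d_x$; $\mathcal B_m=\begin{bmatrix}A_m&B_m\\0&A_m\end{bmatrix}$; $\mathcal Q_{<s}=[1\ \ 0]\prod_{m<s}\mathcal B_m$, $\mathcal Q_{>s}=\big(\prod_{m>s}\mathcal B_m\big)\begin{bmatrix}0\\1\end{bmatrix}$ (ordered products), of sizes $1\times2\varrho_{s-1}r_{s-1}$ and $2\varrho_sr_s\times1$, functions of $z_{<s}=(z_1,\dots,z_{s-1})$ and $z_{>s}=(z_{s+1},\dots,z_d)$. $\otimes$ is the Kronecker product of matrices. Local channels: $\Lambda_s=\{0,1,2\}$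 for $s\le d_x$, $\Lambda_s=\{0\}$ for $s>d_x$, $\mathcal D_{s,\ell}=\partial_{z_s}^\ell$. Operator terms are indexed by $(\tau,q)$, $q=1,\dots,d_x$, with $\mathcal A=\sum_{\tau,q}\bigotimes_m\mathcal A_m^{(\tau,q)}$, $\mathcal A_s^{(\tau,q)}h=-\kappa_{\tau,s}'h'-\kappa_{\tau,s}h''$ if $s=q$, $\kappa_{\tau,s}h$ otherwise; channel coefficients $b_{s,0}^{(\tau,q)}=(1-\delta_{sq})\kappa_{\tau,s}$, $b_{s,1}^{(\tau,q)}=-\delta_{sq}\kappa_{\tau,s}'$, $b_{s,2}^{(\tau,q)}=-\delta_{sq}\kappa_{\tau,s}$ for $s\le d_x$, and $b_{s,0}^{(\tau,q)}=\kappa_{\tau,s}$ for $s>d_x$. Collocation: $\overline{i_1\ldots i_k}$ is the lexicographic position (leftmost index slowest); grids $\{z_{m,1},\dots,z_{m,n_m}\}\subset\mathcal D_m$; $N_{\mathcal D}=\prod_mn_m$; $z_i=(z_{1,i_1},\dots,z_{d,i_d})$ for $i=\overline{i_1\ldots i_d}$; $\mathrm J_s(i,p)=(\mathcal A\partial_{\theta^s_p}u_\theta)(z_i)$. $\mathsf H_{s,\ell}(\overline{i_sa_s},p)=(\partial_{z_s}^\ell\partial_{\theta^s_p}G_s)(z_{s,i_s})(\alpha_{s-1},\alpha_s)$; $\mathsf C_s^{\mathrm{ch}}$ is the vertical stack of $\mathsf H_{s,0},\mathsf H_{s,1},\mathsf H_{s,2}$ for $s\le d_x$ and $\mathsf H_{s,0}$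 for $s>d_x$. The local-channel direction matrices are defined in general by $\delta_{i_sj_s}\sum_{(\tau,q)}b_{s,\ell}^{(\tau,q)}(z_{s,j_s})\,\mathsf E_s^{(\tau,q)}(\overline{i_{-s}},a_s)$ (entry $(i,\overline{j_sa_s})$), where $i_{-s}$ omits $i_s$ and $\mathsf E_s^{(\tau,q)}(\overline{i_{-s}},a_s)=\big[\prod_{m<s}(\mathcal A_m^{(\tau,q)}G_m)(z_{m,i_m})\big]\mathsf M_{a_s}\big[\prod_{m>s}(\mathcal A_m^{(\tau,q)}G_m)(z_{m,i_m})\big]$ (operators applied entrywise, empty products equal $1$). *)

theory Defs
  imports "HOL-Analysis.Analysis" "Jordan_Normal_Form.Matrix"
begin

text \<open>
  Coordinates are numbered 1, ..., d with d = dx + dxi, so z = (x, xi) is a function z with x_m = z m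
  for m \<le> dx and xi_j = z (dx + j).  Everything that indexes a matrix (grid points, ranks, parameters)
  is numbered from 0, as in the matrix library.
\<close>

section \<open>Lexicographic positions\<close>

text \<open>
  \<open>lex_pos n ms i\<close> is the position (counted from 0) of the multi-index \<open>i\<close> with digits \<open>i m < n m\<close>,
  \<open>m\<close> running through the list \<open>ms\<close>, leftmost digit slowest; \<open>lex_digits\<close> recovers the digits.
\<close>

fun lex_pos :: "(nat \<Rightarrow> nat) \<Rightarrow> nat list \<Rightarrow> (nat \<Rightarrow> nat) \<Rightarrow> nat" where
  "lex_pos n [] i = 0"
| "lex_pos n (m # ms) i = i m * prod_list (map n ms) + lex_pos n ms i"

fun lex_digits :: "(nat \<Rightarrow> nat) \<Rightarrow> nat list \<Rightarrow> nat \<Rightarrow> nat \<Rightarrow> nat" where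
  "lex_digits n [] p = (\<lambda>_. 0)"
| "lex_digits n (m # ms) p =
     (lex_digits n ms (p mod prod_list (map n ms)))(m := p div prod_list (map n ms))"

lemma lex_pos_less:
  "(\<And>m. m \<in> set ms \<Longrightarrow> i m < n m) \<Longrightarrow> lex_pos n ms i < prod_list (map n ms)"
proof (induction ms)
  case (Cons m ms)
  have "lex_pos n ms i < prod_list (map n ms)" using Cons by simp
  then have "lex_pos n (m # ms) i < Suc (i m) * prod_list (map n ms)" by simp
  also have "\<dots> \<le> n m * prod_list (map n ms)"
    using Cons.prems[of m] by (intro mult_le_mono1) (simp add: Suc_le_eq)
  finally show ?case by simp
qed simp

lemma lex_digits_lex_pos:
  "(\<And>m. m \<in> set ms \<Longrightarrow> i m < n m) \<Longrightarrow> distinct ms \<Longrightarrow> m \<in> set ms \<Longrightarrow>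
   lex_digits n ms (lex_pos n ms i) m = i m"
proof (induction ms)
  case (Cons m' ms)
  have "lex_pos n ms i < prod_list (map n ms)" using Cons.prems(1) by (intro lex_pos_less) simp
  then show ?case using Cons by auto
qed simp

section \<open>Matrices\<close>

definition kron :: "real mat \<Rightarrow> real mat \<Rightarrow> real mat" where
  "kron A B = mat (dim_row A * dim_row B) (dim_col A * dim_col B)
     (\<lambda>(i, j). A $$ (i div dim_row B, j div dim_col B) * B $$ (i mod dim_row B, j mod dim_col B))"

definition append_cols :: "real mat \<Rightarrow> real mat \<Rightarrow> real mat" where
  "append_cols A B = four_block_mat A B (0\<^sub>m 0 (dim_col A)) (0\<^sub>m 0 (dim_col B))"

text \<open>Ordered products, multiplied onto a given matrix \<open>A\<close> from the right resp. from the left.\<close>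

definition prod_right :: "real mat \<Rightarrow> (nat \<Rightarrow> real mat) \<Rightarrow> nat list \<Rightarrow> real mat" where
  "prod_right A F ms = foldl (\<lambda>X m. X * F m) A ms"

definition prod_left :: "(nat \<Rightarrow> real mat) \<Rightarrow> nat list \<Rightarrow> real mat \<Rightarrow> real mat" where
  "prod_left F ms A = foldr (\<lambda>m X. F m * X) ms A"

definition mat_deriv :: "(real \<Rightarrow> real mat) \<Rightarrow> real \<Rightarrow> real mat" where
  "mat_deriv F x = mat (dim_row (F x)) (dim_col (F x)) (\<lambda>ij. deriv (\<lambda>t. F t $$ ij) x)"

section \<open>The quadratic Darcy operator\<close>

definition Dom :: "nat \<Rightarrow> nat \<Rightarrow> real set" where
  "Dom dx m = (if m \<le> dx then {0<..<1} else {-1<..<1})"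

definition eps :: real where "eps = 1 / 2"

definition wgt :: "nat \<Rightarrow> nat \<Rightarrow> real" where
  "wgt dxi j = (1 / (real j)\<^sup>2) / (\<Sum>k=1..dxi. 1 / (real k)\<^sup>2)"

definition psi :: "nat \<Rightarrow> (nat \<Rightarrow> real) \<Rightarrow> real" where
  "psi dx z = (\<Prod>m=1..dx. cos (pi * z m))"

definition kappa_quad :: "nat \<Rightarrow> nat \<Rightarrow> (nat \<Rightarrow> real) \<Rightarrow> real" where
  "kappa_quad dx dxi z = (1 + eps * psi dx z * (\<Sum>j=1..dxi. wgt dxi j * z (dx + j)))\<^sup>2"

definition pderiv_coord :: "nat \<Rightarrow> ((nat \<Rightarrow> real) \<Rightarrow> real) \<Rightarrow> (nat \<Rightarrow> real) \<Rightarrow> real" where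
  "pderiv_coord q v z = deriv (\<lambda>t. v (z(q := t))) (z q)"

definition darcy ::
  "nat \<Rightarrow> nat \<Rightarrow> ((nat \<Rightarrow> real) \<Rightarrow> real) \<Rightarrow> (nat \<Rightarrow> real) \<Rightarrow> real" where
  "darcy dx dxi v z =
     - (\<Sum>q=1..dx. pderiv_coord q (\<lambda>y. kappa_quad dx dxi y * pderiv_coord q v y) z)"

text \<open>The summands of the expanded square, and their factorizations into univariate functions.\<close>

datatype qterm = TOne | TLin nat | TSq nat | TMix nat nat

definition qterms :: "nat \<Rightarrow> qterm set" where
  "qterms dxi = {TOne} \<union> TLin ` {1..dxi} \<union> TSq ` {1..dxi}
     \<union> {TMix j k | j k. 1 \<le> j \<and> j < k \<and> k \<le> dxi}"

fun qterm_fun :: "nat \<Rightarrow> nat \<Rightarrow> qterm \<Rightarrow> (nat \<Rightarrow> real) \<Rightarrow> real" where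
  "qterm_fun dx dxi TOne z = 1"
| "qterm_fun dx dxi (TLin j) z = 2 * eps * wgt dxi j * psi dx z * z (dx + j)"
| "qterm_fun dx dxi (TSq j) z = eps\<^sup>2 * (wgt dxi j)\<^sup>2 * (psi dx z)\<^sup>2 * (z (dx + j))\<^sup>2"
| "qterm_fun dx dxi (TMix j k) z =
     2 * eps\<^sup>2 * wgt dxi j * wgt dxi k * (psi dx z)\<^sup>2 * z (dx + j) * z (dx + k)"

text \<open>
  It is left open which univariate factor of a summand carries its scalar coefficient.
\<close>

definition separable_factors :: "nat \<Rightarrow> nat \<Rightarrow> (qterm \<Rightarrow> nat \<Rightarrow> real \<Rightarrow> real) \<Rightarrow> bool" where
  "separable_factors dx dxi \<kappa> \<longleftrightarrow>
     (\<forall>\<tau>\<in>qterms dxi.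
        (\<forall>z. (\<forall>m\<in>{1..dx+dxi}. z m \<in> Dom dx m) \<longrightarrow>
             (\<Prod>m=1..dx+dxi. \<kappa> \<tau> m (z m)) = qterm_fun dx dxi \<tau> z) \<and>
        (\<forall>m\<in>{1..dx}. \<kappa> \<tau> m differentiable_on Dom dx m))"

section \<open>Function spaces\<close>

definition L2 :: "'a measure \<Rightarrow> ('a \<Rightarrow> real) \<Rightarrow> bool" where
  "L2 M f \<longleftrightarrow> f \<in> borel_measurable M \<and> integrable M (\<lambda>x. (f x)\<^sup>2)"

definition L2_norm :: "'a measure \<Rightarrow> ('a \<Rightarrow> real) \<Rightarrow> real" where
  "L2_norm M f = sqrt (integral\<^sup>L M (\<lambda>x. (f x)\<^sup>2))"

definition coord_measure :: "nat \<Rightarrow> nat \<Rightarrow> real measure" where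
  "coord_measure dx m = restrict_space lborel (Dom dx m)"

definition box_measure :: "nat \<Rightarrow> nat set \<Rightarrow> (nat \<Rightarrow> real) measure" where
  "box_measure dx I = PiM I (coord_measure dx)"

definition test_fun :: "real set \<Rightarrow> (real \<Rightarrow> real) \<Rightarrow> bool" where
  "test_fun I \<phi> \<longleftrightarrow> (\<forall>k. (deriv ^^ k) \<phi> differentiable_on UNIV) \<and>
     (\<exists>K. compact K \<and> K \<subseteq> I \<and> (\<forall>x. x \<notin> K \<longrightarrow> \<phi> x = 0))"

definition weak_deriv :: "nat \<Rightarrow> nat \<Rightarrow> nat \<Rightarrow> (real \<Rightarrow> real) \<Rightarrow> (real \<Rightarrow> real) \<Rightarrow> bool" where
  "weak_deriv dx m l f g \<longleftrightarrow> (\<forall>\<phi>. test_fun (Dom dx m) \<phi> \<longrightarrow>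
     (LINT t|coord_measure dx m. f t * (deriv ^^ l) \<phi> t)
       = (-1) ^ l * (LINT t|coord_measure dx m. g t * \<phi> t))"

text \<open>
  A closed subspace \<open>X\<close> of an abstract Hilbert space, whose elements are regarded as functions in
  L2(M) (up to null sets) by means of \<open>rep\<close>.
\<close>

definition L2_function_space ::
  "'a measure \<Rightarrow> 'h::{real_inner,complete_space} set \<Rightarrow> ('h \<Rightarrow> 'a \<Rightarrow> real) \<Rightarrow> bool" where
  "L2_function_space M X rep \<longleftrightarrow> subspace X \<and> closed X \<and>
     (\<forall>h\<in>X. L2 M (rep h)) \<and>
     (\<forall>g\<in>X. \<forall>h\<in>X. \<forall>a b. AE x in M. rep (a *\<^sub>R g + b *\<^sub>R h) x = a * rep g x + b * rep h x) \<and>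
     (\<forall>h\<in>X. (AE x in M. rep h x = 0) \<longrightarrow> h = 0) \<and>
     (\<exists>B. \<forall>h\<in>X. L2_norm M (rep h) \<le> B * norm h)"

definition max_order :: "nat \<Rightarrow> nat \<Rightarrow> nat" where
  "max_order dx m = (if m \<le> dx then 2 else 0)"

definition univariate_space ::
  "nat \<Rightarrow> nat \<Rightarrow> 'h::{real_inner,complete_space} set \<Rightarrow> ('h \<Rightarrow> real \<Rightarrow> real) \<Rightarrow> bool" where
  "univariate_space dx m X rep \<longleftrightarrow> L2_function_space (coord_measure dx m) X rep \<and>
     (\<forall>l \<le> max_order dx m. \<exists>B. \<forall>h\<in>X. \<exists>g. L2 (coord_measure dx m) g \<and>
        weak_deriv dx m l (rep h) g \<and> L2_norm (coord_measure dx m) g \<le> B * norm h)"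

text \<open>
  U = L2(Xi; V), with V given by the Hilbert type \<open>'v\<close> (separable, so Borel measurability is strong
  measurability) and its realization in L2(Omega) by \<open>repV\<close>; \<open>realized_by\<close> regards an element of U
  as a function on the whole domain.
\<close>

definition in_U ::
  "nat \<Rightarrow> nat \<Rightarrow> ((nat \<Rightarrow> real) \<Rightarrow> 'v::{real_inner,complete_space,second_countable_topology}) \<Rightarrow> bool"
  where
  "in_U dx dxi u \<longleftrightarrow> u \<in> borel_measurable (box_measure dx {dx+1..dx+dxi}) \<and>
     integrable (box_measure dx {dx+1..dx+dxi}) (\<lambda>y. (norm (u y))\<^sup>2)"

definition U_norm ::
  "nat \<Rightarrow> nat \<Rightarrow> ((nat \<Rightarrow> real) \<Rightarrow> 'v::{real_inner,complete_space,second_countable_topology}) \<Rightarrow> real"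
  where
  "U_norm dx dxi u = sqrt (LINT y|box_measure dx {dx+1..dx+dxi}. (norm (u y))\<^sup>2)"

definition realized_by ::
  "nat \<Rightarrow> nat \<Rightarrow> ('v \<Rightarrow> (nat \<Rightarrow> real) \<Rightarrow> real) \<Rightarrow>
   ((nat \<Rightarrow> real) \<Rightarrow> 'v) \<Rightarrow> ((nat \<Rightarrow> real) \<Rightarrow> real) \<Rightarrow> bool" where
  "realized_by dx dxi repV u f \<longleftrightarrow> L2 (box_measure dx {1..dx+dxi}) f \<and>
     (AE y in box_measure dx {dx+1..dx+dxi}. AE x in box_measure dx {1..dx}.
        repV (u y) x = f (merge {1..dx} {dx+1..dx+dxi} (x, y)))"

definition tensor_sum ::
  "nat \<Rightarrow> (nat \<Rightarrow> 'h \<Rightarrow> real \<Rightarrow> real) \<Rightarrow> nat \<Rightarrow> (nat \<Rightarrow> nat \<Rightarrow> 'h) \<Rightarrow> (nat \<Rightarrow> real) \<Rightarrow> real" where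
  "tensor_sum d rep N h z = (\<Sum>k<N. \<Prod>m=1..d. rep m (h k m) (z m))"

text \<open>Square of the Hilbert tensor norm of \<open>\<Sum>k<N. h k 1 \<otimes> \<dots> \<otimes> h k d\<close>.\<close>

definition tensor_norm_sq :: "nat \<Rightarrow> nat \<Rightarrow> (nat \<Rightarrow> nat \<Rightarrow> 'h::real_inner) \<Rightarrow> real" where
  "tensor_norm_sq d N h = (\<Sum>k<N. \<Sum>k'<N. \<Prod>m=1..d. inner (h k m) (h k' m))"

text \<open>
  \<open>g\<close> is the image of \<open>f\<close> under the Darcy operator in the sense of distributions: the operator is
  formally self-adjoint, and products of univariate test functions suffice.
\<close>

definition weak_darcy ::
  "nat \<Rightarrow> nat \<Rightarrow> ((nat \<Rightarrow> real) \<Rightarrow> real) \<Rightarrow> ((nat \<Rightarrow> real) \<Rightarrow> real) \<Rightarrow> bool" where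
  "weak_darcy dx dxi f g \<longleftrightarrow> (\<forall>\<phi>. (\<forall>m\<in>{1..dx+dxi}. test_fun (Dom dx m) (\<phi> m)) \<longrightarrow>
     (LINT z|box_measure dx {1..dx+dxi}. g z * (\<Prod>m=1..dx+dxi. \<phi> m (z m)))
       = (LINT z|box_measure dx {1..dx+dxi}.
            f z * darcy dx dxi (\<lambda>y. \<Prod>m=1..dx+dxi. \<phi> m (y m)) z))"

definition space_setting ::
  "nat \<Rightarrow> nat \<Rightarrow> (nat \<Rightarrow> 'h::{real_inner,complete_space} set) \<Rightarrow> (nat \<Rightarrow> 'h \<Rightarrow> real \<Rightarrow> real) \<Rightarrow>
   ('v::{real_inner,complete_space,second_countable_topology} \<Rightarrow> (nat \<Rightarrow> real) \<Rightarrow> real) \<Rightarrow> bool" where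
  "space_setting dx dxi H rep repV \<longleftrightarrow>
     (\<forall>m\<in>{1..dx+dxi}. univariate_space dx m (H m) (rep m)) \<and>
     L2_function_space (box_measure dx {1..dx}) UNIV repV \<and>
     \<comment> \<open>the tensor product of the univariate spaces is continuously ...\<close>
     (\<exists>B. \<forall>N h. (\<forall>k<N. \<forall>m\<in>{1..dx+dxi}. h k m \<in> H m) \<longrightarrow>
        (\<exists>u. in_U dx dxi u \<and> realized_by dx dxi repV u (tensor_sum (dx+dxi) rep N h) \<and>
             (U_norm dx dxi u)\<^sup>2 \<le> B * tensor_norm_sq (dx+dxi) N h)) \<and>
     \<comment> \<open>... and densely embedded in U\<close>
     (\<forall>u. in_U dx dxi u \<longrightarrow> (\<forall>e>0. \<exists>N h v. (\<forall>k<N. \<forall>m\<in>{1..dx+dxi}. h k m \<in> H m) \<and>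
        in_U dx dxi v \<and> realized_by dx dxi repV v (tensor_sum (dx+dxi) rep N h) \<and>
        U_norm dx dxi (\<lambda>y. u y - v y) < e)) \<and>
     \<comment> \<open>the Darcy operator is bounded from U to L2\<close>
     (\<exists>B. \<forall>u. in_U dx dxi u \<longrightarrow> (\<exists>f g. realized_by dx dxi repV u f \<and>
        L2 (box_measure dx {1..dx+dxi}) g \<and> weak_darcy dx dxi f g \<and>
        L2_norm (box_measure dx {1..dx+dxi}) g \<le> B * U_norm dx dxi u))"

section \<open>Tensor-train ansatz\<close>

text \<open>The Banach space of k times continuously differentiable functions on a compact interval.\<close>

definition deriv_within :: "real set \<Rightarrow> (real \<Rightarrow> real) \<Rightarrow> real \<Rightarrow> real" where
  "deriv_within S f = (\<lambda>x. vector_derivative f (at x within S))"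

definition Ck_on :: "nat \<Rightarrow> real set \<Rightarrow> (real \<Rightarrow> real) \<Rightarrow> bool" where
  "Ck_on k S f \<longleftrightarrow> (\<forall>l<k. (deriv_within S ^^ l) f differentiable_on S) \<and>
     continuous_on S ((deriv_within S ^^ k) f)"

definition Ck_norm :: "nat \<Rightarrow> real set \<Rightarrow> (real \<Rightarrow> real) \<Rightarrow> real" where
  "Ck_norm k S f = (\<Sum>l\<le>k. SUP x\<in>S. \<bar>(deriv_within S ^^ l) f x\<bar>)"

text \<open>Frechet differentiability of a map from R^P (vectors of length P) into that space.\<close>

definition Ck_differentiable_at ::
  "nat \<Rightarrow> real set \<Rightarrow> nat \<Rightarrow> (real vec \<Rightarrow> real \<Rightarrow> real) \<Rightarrow> real vec \<Rightarrow> bool" where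
  "Ck_differentiable_at k S P F \<theta> \<longleftrightarrow> (\<exists>D. (\<forall>p<P. Ck_on k S (D p)) \<and>
     (\<forall>e>0. \<exists>\<delta>>0. \<forall>h\<in>carrier_vec P. sqrt (scalar_prod h h) < \<delta> \<longrightarrow>
        Ck_norm k S (\<lambda>t. F (\<theta> + h) t - F \<theta> t - (\<Sum>p<P. vec_index h p * D p t))
          \<le> e * sqrt (scalar_prod h h)))"

definition tt_ansatz ::
  "nat \<Rightarrow> nat \<Rightarrow> (nat \<Rightarrow> nat) \<Rightarrow> (nat \<Rightarrow> nat) \<Rightarrow>
   (nat \<Rightarrow> 'h set) \<Rightarrow> (nat \<Rightarrow> 'h \<Rightarrow> real \<Rightarrow> real) \<Rightarrow> (nat \<Rightarrow> real vec \<Rightarrow> real \<Rightarrow> real mat) \<Rightarrow> bool"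
  where
  "tt_ansatz dx dxi r P H rep G \<longleftrightarrow> r 0 = 1 \<and> r (dx + dxi) = 1 \<and>
     (\<forall>m\<in>{1..dx+dxi}. \<forall>\<theta>\<in>carrier_vec (P m).
        (\<forall>t. G m \<theta> t \<in> carrier_mat (r (m-1)) (r m)) \<and>
        (\<forall>\<alpha><r (m-1). \<forall>\<beta><r m.
           (\<exists>h\<in>H m. AE t in coord_measure dx m. rep m h t = G m \<theta> t $$ (\<alpha>, \<beta>)) \<and>
           Ck_on (max_order dx m) (closure (Dom dx m)) (\<lambda>t. G m \<theta> t $$ (\<alpha>, \<beta>)) \<and>
           Ck_differentiable_at (max_order dx m) (closure (Dom dx m)) (P m)
             (\<lambda>\<theta>' t. G m \<theta>' t $$ (\<alpha>, \<beta>)) \<theta>))"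

definition tt_fun ::
  "nat \<Rightarrow> (nat \<Rightarrow> real vec \<Rightarrow> real \<Rightarrow> real mat) \<Rightarrow> (nat \<Rightarrow> real vec) \<Rightarrow> (nat \<Rightarrow> real) \<Rightarrow> real" where
  "tt_fun d G \<theta> z = prod_right (1\<^sub>m 1) (\<lambda>m. G m (\<theta> m) (z m)) [1..<d+1] $$ (0, 0)"

text \<open>Partial derivatives with respect to component p of the parameter vector of core s.\<close>

definition param_deriv_u ::
  "nat \<Rightarrow> (nat \<Rightarrow> nat) \<Rightarrow> (nat \<Rightarrow> real vec \<Rightarrow> real \<Rightarrow> real mat) \<Rightarrow> (nat \<Rightarrow> real vec) \<Rightarrow>
   nat \<Rightarrow> nat \<Rightarrow> (nat \<Rightarrow> real) \<Rightarrow> real" where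
  "param_deriv_u d P G \<theta> s p z =
     deriv (\<lambda>t. tt_fun d G (\<theta>(s := \<theta> s + t \<cdot>\<^sub>v unit_vec (P s) p)) z) 0"

definition param_deriv_G ::
  "(nat \<Rightarrow> nat) \<Rightarrow> (nat \<Rightarrow> real vec \<Rightarrow> real \<Rightarrow> real mat) \<Rightarrow> (nat \<Rightarrow> real vec) \<Rightarrow>
   nat \<Rightarrow> nat \<Rightarrow> nat \<times> nat \<Rightarrow> real \<Rightarrow> real" where
  "param_deriv_G P G \<theta> s p \<alpha>\<beta> x =
     deriv (\<lambda>t. G s (\<theta> s + t \<cdot>\<^sub>v unit_vec (P s) p) x $$ \<alpha>\<beta>) 0"

section \<open>Coefficient cores and block cores\<close>

definition K_core :: "real \<Rightarrow> real mat" where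
  "K_core x = mat_of_rows_list 3
     [[1, 0, 0], [0, cos (pi * x), 0], [0, 0, (cos (pi * x))\<^sup>2]]"

definition M_core :: "nat \<Rightarrow> nat \<Rightarrow> real \<Rightarrow> real mat" where
  "M_core dxi j y = (let \<sigma> = wgt dxi j * y in
     mat_of_rows_list 3 [[1, 0, 0], [\<sigma>, 1, 0], [\<sigma>\<^sup>2, 2 * \<sigma>, 1]])"

definition C_core :: "nat \<Rightarrow> nat \<Rightarrow> nat \<Rightarrow> real \<Rightarrow> real mat" where
  "C_core dx dxi m t =
     (if m = 1 then mat_of_rows_list 3 [[1, 2 * eps, eps\<^sup>2]] * K_core t
      else if m \<le> dx then K_core t
      else if m < dx + dxi then M_core dxi (m - dx) t
      else M_core dxi dxi t * mat_of_rows_list 1 [[1], [0], [0]])"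

text \<open>From here on \<open>g m\<close> stands for the core \<open>G m (\<theta> m)\<close> at the fixed parameter.\<close>

definition A_core :: "nat \<Rightarrow> nat \<Rightarrow> (nat \<Rightarrow> real \<Rightarrow> real mat) \<Rightarrow> nat \<Rightarrow> real \<Rightarrow> real mat" where
  "A_core dx dxi g m t = kron (C_core dx dxi m t) (g m t)"

definition B_core :: "nat \<Rightarrow> nat \<Rightarrow> (nat \<Rightarrow> real \<Rightarrow> real mat) \<Rightarrow> nat \<Rightarrow> real \<Rightarrow> real mat" where
  "B_core dx dxi g m t =
     (if m \<le> dx
      then - kron (mat_deriv (C_core dx dxi m) t) (mat_deriv (g m) t)
           - kron (C_core dx dxi m t) (mat_deriv (mat_deriv (g m)) t)
      else 0\<^sub>m (dim_row (A_core dx dxi g m t)) (dim_col (A_core dx dxi g m t)))"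

definition block_core :: "nat \<Rightarrow> nat \<Rightarrow> (nat \<Rightarrow> real \<Rightarrow> real mat) \<Rightarrow> nat \<Rightarrow> real \<Rightarrow> real mat" where
  "block_core dx dxi g m t =
     four_block_mat (A_core dx dxi g m t) (B_core dx dxi g m t)
       (0\<^sub>m (dim_row (A_core dx dxi g m t)) (dim_col (A_core dx dxi g m t))) (A_core dx dxi g m t)"

definition Q_less ::
  "nat \<Rightarrow> nat \<Rightarrow> (nat \<Rightarrow> real \<Rightarrow> real mat) \<Rightarrow> nat \<Rightarrow> (nat \<Rightarrow> real) \<Rightarrow> real mat" where
  "Q_less dx dxi g s z =
     prod_right (mat_of_rows_list 2 [[1, 0]]) (\<lambda>m. block_core dx dxi g m (z m)) [1..<s]"

definition Q_greater ::
  "nat \<Rightarrow> nat \<Rightarrow> (nat \<Rightarrow> real \<Rightarrow> real mat) \<Rightarrow> nat \<Rightarrow> (nat \<Rightarrow> real) \<Rightarrow> real mat" where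
  "Q_greater dx dxi g s z =
     prod_left (\<lambda>m. block_core dx dxi g m (z m)) [s+1..<dx+dxi+1] (mat_of_rows_list 1 [[0], [1]])"

definition rank_prod :: "(nat \<Rightarrow> nat) \<Rightarrow> nat \<Rightarrow> nat" where
  "rank_prod r s = r (s - 1) * r s"

text \<open>
  The index \<open>a\<close> is the lexicographic position of the pair (a div r s, a mod r s) of rank indices;
  likewise a position \<open>c\<close> of a pair (grid index of coordinate s, rank pair) is split below into
  \<open>c div rank_prod r s\<close> and \<open>c mod rank_prod r s\<close>.
\<close>

definition unit_mat :: "(nat \<Rightarrow> nat) \<Rightarrow> nat \<Rightarrow> nat \<Rightarrow> real mat" where
  "unit_mat r s a = mat (r (s - 1)) (r s) (\<lambda>ij. if ij = (a div r s, a mod r s) then 1 else 0)"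

definition channels :: "nat \<Rightarrow> nat \<Rightarrow> nat set" where
  "channels dx s = (if s \<le> dx then {0, 1, 2} else {0})"

definition P_mat :: "nat \<Rightarrow> nat \<Rightarrow> (nat \<Rightarrow> nat) \<Rightarrow> nat \<Rightarrow> nat \<Rightarrow> nat \<Rightarrow> real \<Rightarrow> real mat" where
  "P_mat dx dxi r s l a t =
     (let M = unit_mat r s a;
          X = kron (C_core dx dxi s t) M;
          Z = 0\<^sub>m (dim_row X) (dim_col X)
      in if l = 0 then four_block_mat X Z Z X
         else if l = 1 then four_block_mat Z (- kron (mat_deriv (C_core dx dxi s) t) M) Z Z
         else four_block_mat Z (- X) Z Z)"

section \<open>Collocation\<close>

definition N_grid :: "nat \<Rightarrow> (nat \<Rightarrow> nat) \<Rightarrow> nat" where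
  "N_grid d n = (\<Prod>m=1..d. n m)"

definition Jac ::
  "nat \<Rightarrow> nat \<Rightarrow> (nat \<Rightarrow> nat) \<Rightarrow> (nat \<Rightarrow> nat) \<Rightarrow> (nat \<Rightarrow> nat \<Rightarrow> real) \<Rightarrow>
   (nat \<Rightarrow> real vec \<Rightarrow> real \<Rightarrow> real mat) \<Rightarrow> (nat \<Rightarrow> real vec) \<Rightarrow> nat \<Rightarrow> real mat" where
  "Jac dx dxi n P pt G \<theta> s = mat (N_grid (dx+dxi) n) (P s)
     (\<lambda>(row, p). darcy dx dxi (param_deriv_u (dx+dxi) P G \<theta> s p)
        (\<lambda>m. pt m (lex_digits n [1..<dx+dxi+1] row m)))"

definition H_mat ::
  "(nat \<Rightarrow> nat) \<Rightarrow> (nat \<Rightarrow> nat) \<Rightarrow> (nat \<Rightarrow> nat) \<Rightarrow> (nat \<Rightarrow> nat \<Rightarrow> real) \<Rightarrow>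
   (nat \<Rightarrow> real vec \<Rightarrow> real \<Rightarrow> real mat) \<Rightarrow> (nat \<Rightarrow> real vec) \<Rightarrow> nat \<Rightarrow> nat \<Rightarrow> real mat" where
  "H_mat n r P pt G \<theta> s l = mat (n s * rank_prod r s) (P s)
     (\<lambda>(row, p). let j = row div rank_prod r s; a = row mod rank_prod r s in
        (deriv ^^ l) (param_deriv_G P G \<theta> s p (a div r s, a mod r s)) (pt s j))"

definition C_channel ::
  "nat \<Rightarrow> (nat \<Rightarrow> nat) \<Rightarrow> (nat \<Rightarrow> nat) \<Rightarrow> (nat \<Rightarrow> nat) \<Rightarrow> (nat \<Rightarrow> nat \<Rightarrow> real) \<Rightarrow>
   (nat \<Rightarrow> real vec \<Rightarrow> real \<Rightarrow> real mat) \<Rightarrow> (nat \<Rightarrow> real vec) \<Rightarrow> nat \<Rightarrow> real mat" where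
  "C_channel dx n r P pt G \<theta> s =
     (if s \<le> dx
      then H_mat n r P pt G \<theta> s 0 @\<^sub>r (H_mat n r P pt G \<theta> s 1 @\<^sub>r H_mat n r P pt G \<theta> s 2)
      else H_mat n r P pt G \<theta> s 0)"

text \<open>
  The local-channel direction matrices as defined for a general separable operator, here with the
  terms (tau, q) of the Darcy operator and \<open>\<kappa> \<tau> m\<close> the univariate factors of its coefficient.
\<close>

definition op_factor ::
  "(qterm \<Rightarrow> nat \<Rightarrow> real \<Rightarrow> real) \<Rightarrow> qterm \<Rightarrow> nat \<Rightarrow> nat \<Rightarrow> (real \<Rightarrow> real) \<Rightarrow> real \<Rightarrow> real" where
  "op_factor \<kappa> \<tau> q m h t =
     (if m = q then - deriv (\<kappa> \<tau> m) t * deriv h t - \<kappa> \<tau> m t * (deriv ^^ 2) h t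
      else \<kappa> \<tau> m t * h t)"

definition op_factor_mat ::
  "(qterm \<Rightarrow> nat \<Rightarrow> real \<Rightarrow> real) \<Rightarrow> qterm \<Rightarrow> nat \<Rightarrow> nat \<Rightarrow> (real \<Rightarrow> real mat) \<Rightarrow> real \<Rightarrow> real mat" where
  "op_factor_mat \<kappa> \<tau> q m F t =
     mat (dim_row (F t)) (dim_col (F t)) (\<lambda>ij. op_factor \<kappa> \<tau> q m (\<lambda>x. F x $$ ij) t)"

definition channel_coeff ::
  "nat \<Rightarrow> (qterm \<Rightarrow> nat \<Rightarrow> real \<Rightarrow> real) \<Rightarrow> nat \<Rightarrow> nat \<Rightarrow> qterm \<Rightarrow> nat \<Rightarrow> real \<Rightarrow> real" where
  "channel_coeff dx \<kappa> s l \<tau> q t =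
     (if s \<le> dx then
        (if l = 0 then (if s = q then 0 else \<kappa> \<tau> s t)
         else if l = 1 then (if s = q then - deriv (\<kappa> \<tau> s) t else 0)
         else (if s = q then - \<kappa> \<tau> s t else 0))
      else \<kappa> \<tau> s t)"

definition others :: "nat \<Rightarrow> nat \<Rightarrow> nat list" where
  "others d s = filter (\<lambda>m. m \<noteq> s) [1..<d+1]"

definition E_mat ::
  "nat \<Rightarrow> (nat \<Rightarrow> nat) \<Rightarrow> (nat \<Rightarrow> nat) \<Rightarrow> (nat \<Rightarrow> nat \<Rightarrow> real) \<Rightarrow> (nat \<Rightarrow> real \<Rightarrow> real mat) \<Rightarrow>
   (qterm \<Rightarrow> nat \<Rightarrow> real \<Rightarrow> real) \<Rightarrow> nat \<Rightarrow> qterm \<Rightarrow> nat \<Rightarrow> real mat" where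
  "E_mat d n r pt g \<kappa> s \<tau> q = mat (\<Prod>m\<in>{1..d} - {s}. n m) (rank_prod r s)
     (\<lambda>(row, a). let F = (\<lambda>m. op_factor_mat \<kappa> \<tau> q m (g m) (pt m (lex_digits n (others d s) row m)))
        in (prod_right (1\<^sub>m 1) F [1..<s] * unit_mat r s a * prod_left F [s+1..<d+1] (1\<^sub>m 1)) $$ (0, 0))"

definition Psi_channel ::
  "nat \<Rightarrow> nat \<Rightarrow> (nat \<Rightarrow> nat) \<Rightarrow> (nat \<Rightarrow> nat) \<Rightarrow> (nat \<Rightarrow> nat \<Rightarrow> real) \<Rightarrow>
   (nat \<Rightarrow> real \<Rightarrow> real mat) \<Rightarrow> (qterm \<Rightarrow> nat \<Rightarrow> real \<Rightarrow> real) \<Rightarrow> nat \<Rightarrow> nat \<Rightarrow> real mat" where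
  "Psi_channel dx dxi n r pt g \<kappa> s l = mat (N_grid (dx+dxi) n) (n s * rank_prod r s)
     (\<lambda>(row, col).
        let i = lex_digits n [1..<dx+dxi+1] row;
            j = col div rank_prod r s; a = col mod rank_prod r s
        in if i s = j
           then \<Sum>(\<tau>, q)\<in>qterms dxi \<times> {1..dx}. channel_coeff dx \<kappa> s l \<tau> q (pt s j)
                  * E_mat (dx+dxi) n r pt g \<kappa> s \<tau> q $$ (lex_pos n (others (dx+dxi) s) i, a)
           else 0)"

definition Psi_quad ::
  "nat \<Rightarrow> nat \<Rightarrow> (nat \<Rightarrow> nat) \<Rightarrow> (nat \<Rightarrow> nat) \<Rightarrow> (nat \<Rightarrow> nat \<Rightarrow> real) \<Rightarrow>
   (nat \<Rightarrow> real \<Rightarrow> real mat) \<Rightarrow> nat \<Rightarrow> nat \<Rightarrow> real mat" where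
  "Psi_quad dx dxi n r pt g s l = mat (N_grid (dx+dxi) n) (n s * rank_prod r s)
     (\<lambda>(row, col).
        let i = lex_digits n [1..<dx+dxi+1] row;
            j = col div rank_prod r s; a = col mod rank_prod r s
        in if i s = j
           then (Q_less dx dxi g s (\<lambda>m. pt m (i m)) * P_mat dx dxi r s l a (pt s j)
                   * Q_greater dx dxi g s (\<lambda>m. pt m (i m))) $$ (0, 0)
           else 0)"

definition Psi_quad_all ::
  "nat \<Rightarrow> nat \<Rightarrow> (nat \<Rightarrow> nat) \<Rightarrow> (nat \<Rightarrow> nat) \<Rightarrow> (nat \<Rightarrow> nat \<Rightarrow> real) \<Rightarrow>
   (nat \<Rightarrow> real \<Rightarrow> real mat) \<Rightarrow> nat \<Rightarrow> real mat" where
  "Psi_quad_all dx dxi n r pt g s =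
     (if s \<le> dx
      then append_cols (Psi_quad dx dxi n r pt g s 0)
             (append_cols (Psi_quad dx dxi n r pt g s 1) (Psi_quad dx dxi n r pt g s 2))
      else Psi_quad dx dxi n r pt g s 0)"

definition N_eff ::
  "nat \<Rightarrow> nat \<Rightarrow> (nat \<Rightarrow> nat) \<Rightarrow> (nat \<Rightarrow> nat) \<Rightarrow> (nat \<Rightarrow> nat \<Rightarrow> real) \<Rightarrow>
   (nat \<Rightarrow> real \<Rightarrow> real mat) \<Rightarrow> nat" where
  "N_eff dx dxi n r pt g = (\<Sum>s=1..dx+dxi. dim_col (Psi_quad_all dx dxi n r pt g s))"

end

theory Submission
  imports Defs
begin

text \<open>
  A product of matrices is linear in each of its factors.  The block cores multiply like dual
  numbers, so the off-diagonal block of their product is a sum in which each core \<open>A\<^sub>q\<close> in turn is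
  replaced by \<open>B\<^sub>q\<close>; the matrices \<open>P\<close> have the same block shape and single out the terms belonging
  to one channel.  By the mixed-product rule every summand splits into a coefficient train times a
  solution train.  The coefficient train evaluates to the coefficient, and with one core
  differentiated to a partial derivative of it, which is also what the sum over the separable terms
  yields.  Differentiating the tensor train slot by slot gives the same sums for the Jacobian, once
  the derivative of the core in slot \<open>s\<close> is expanded in the unit matrices.
\<close>

section \<open>Matrix trains\<close>

text \<open>Everything is compared with one intermediate quantity, \<open>channel_val\<close>, which
  contains \<open>kappa_quad\<close> and its partial derivatives but no separable terms. The reason
  is that the factors \<open>\<kappa>\<close> are prescribed only through their products inside the
  box, so no formula for a single factor or its derivative is available. Hence the identity "the
  products sum to \<open>kappa_quad\<close>" is itself differentiated in one coordinate, and
  uniqueness of the derivative yields the sums that are needed. The second obstacle is that the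
  Jacobian differentiates in a parameter and then twice in space. Exchanging these derivatives is
  avoided: differentiability with values in C^2 makes the parameter derivative of the train again a
  train, with a twice differentiable core in slot \<open>s\<close>, and the operator is applied to
  that train. Products with a hole are handled as scalars \<open>tt_val d (X(s := Y))\<close>, so
  that linearity, differentiation and the choice of a channel all become statements about function
  updates.\<close>

definition prod_upto :: "real mat \<Rightarrow> (nat \<Rightarrow> real mat) \<Rightarrow> nat \<Rightarrow> real mat" where
  "prod_upto A F s = prod_right A F [1..<s+1]"

definition prod_after :: "(nat \<Rightarrow> real mat) \<Rightarrow> nat \<Rightarrow> nat \<Rightarrow> real mat \<Rightarrow> real mat" where
  "prod_after F s d E = prod_left F [s+1..<d+1] E"

text \<open>The ranks are a parameter, because the same lemmas serve the coefficient ranks, the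
  solution ranks and their pointwise product. The boundary ranks 1 make the full product a 1 x 1
  matrix.\<close>

definition train :: "(nat \<Rightarrow> nat) \<Rightarrow> nat \<Rightarrow> (nat \<Rightarrow> real mat) \<Rightarrow> bool" where
  "train \<rho> d X \<longleftrightarrow> \<rho> 0 = 1 \<and> \<rho> d = 1 \<and> (\<forall>m\<in>{1..d}. X m \<in> carrier_mat (\<rho> (m - 1)) (\<rho> m))"

definition tt_val :: "nat \<Rightarrow> (nat \<Rightarrow> real mat) \<Rightarrow> real" where
  "tt_val d X = prod_upto (1\<^sub>m 1) X d $$ (0, 0)"

text \<open>The partial derivative of the value of the train with respect to entry
  \<open>(i, j)\<close> of core \<open>s\<close>. Neither factor sees \<open>X s\<close>.\<close>

definition slot_coeff :: "nat \<Rightarrow> (nat \<Rightarrow> real mat) \<Rightarrow> nat \<Rightarrow> nat \<Rightarrow> nat \<Rightarrow> real" where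
  "slot_coeff d X s i j = prod_upto (1\<^sub>m 1) X (s - 1) $$ (0, i) * prod_after X s d (1\<^sub>m 1) $$ (j, 0)"

lemma prod_upto_0 [simp]: "prod_upto A F 0 = A"
  by (simp add: prod_upto_def prod_right_def)

lemma prod_upto_Suc [simp]: "prod_upto A F (Suc s) = prod_upto A F s * F (Suc s)"
  by (simp add: prod_upto_def prod_right_def)

lemma prod_after_refl [simp]: "prod_after F d d E = E"
  by (simp add: prod_after_def prod_left_def)

lemma prod_after_step: "s < d \<Longrightarrow> prod_after F s d E = F (Suc s) * prod_after F (Suc s) d E"
  unfolding prod_after_def prod_left_def by (subst upt_conv_Cons) auto

lemma prod_upto_cong: "(\<And>m. m \<in> {1..s} \<Longrightarrow> F m = F' m) \<Longrightarrow> prod_upto A F s = prod_upto A F' s"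
  by (induction s) auto

lemma prod_after_cong:
  assumes "\<And>m. m \<in> {s<..d} \<Longrightarrow> F m = F' m" "s \<le> d"
  shows "prod_after F s d A = prod_after F' s d A"
  using assms(2,1) by (induction s rule: inc_induct) (auto simp: prod_after_step)

lemma prod_upto_carrier:
  assumes "A \<in> carrier_mat k (\<rho> 0)" "\<And>m. m \<in> {1..s} \<Longrightarrow> F m \<in> carrier_mat (\<rho> (m - 1)) (\<rho> m)"
  shows "prod_upto A F s \<in> carrier_mat k (\<rho> s)"
  using assms(2)
proof (induction s)
  case (Suc s)
  then have "prod_upto A F s \<in> carrier_mat k (\<rho> s)" by simp
  moreover have "F (Suc s) \<in> carrier_mat (\<rho> s) (\<rho> (Suc s))" using Suc.prems[of "Suc s"] by simp
  ultimately show ?case by simp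
qed (use assms(1) in simp)

lemma prod_after_carrier:
  assumes "E \<in> carrier_mat (\<rho> d) k" "\<And>m. m \<in> {s<..d} \<Longrightarrow> F m \<in> carrier_mat (\<rho> (m - 1)) (\<rho> m)" "s \<le> d"
  shows "prod_after F s d E \<in> carrier_mat (\<rho> s) k"
  using assms(3,2)
proof (induction s rule: inc_induct)
  case (step s)
  have "F (Suc s) \<in> carrier_mat (\<rho> s) (\<rho> (Suc s))" using step.prems[of "Suc s"] step.hyps by simp
  moreover have "prod_after F (Suc s) d E \<in> carrier_mat (\<rho> (Suc s)) k"
    using step.prems by (intro step.IH) auto
  ultimately show ?case using step.hyps by (simp add: prod_after_step)
qed (use assms(1) in simp)

text \<open>Associativity moves the split point down from \<open>d\<close>, one core at a time. The
  border matrices stay general, because plain trains are closed by identities and block trains by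
  the vectors \<open>[1 0]\<close> and \<open>[0; 1]\<close>.\<close>

lemma prod_upto_after:
  assumes "A \<in> carrier_mat k (\<rho> 0)" "E \<in> carrier_mat (\<rho> d) k'"
    "\<And>m. m \<in> {1..d} \<Longrightarrow> F m \<in> carrier_mat (\<rho> (m - 1)) (\<rho> m)" "s \<le> d"
  shows "prod_upto A F s * prod_after F s d E = prod_upto A F d * E"
  using assms(4)
proof (induction s rule: inc_induct)
  case (step s)
  have "F (Suc s) \<in> carrier_mat (\<rho> s) (\<rho> (Suc s))" using assms(3)[of "Suc s"] step.hyps by simp
  moreover have "prod_after F (Suc s) d E \<in> carrier_mat (\<rho> (Suc s)) k'"
    using assms step.hyps by (intro prod_after_carrier) auto
  moreover have "prod_upto A F s \<in> carrier_mat k (\<rho> s)"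
    using assms step.hyps by (intro prod_upto_carrier) auto
  ultimately show ?case using step.IH step.hyps by (simp add: prod_after_step)
qed simp

lemma prod_split_slot:
  assumes "A \<in> carrier_mat k (\<rho> 0)" "E \<in> carrier_mat (\<rho> d) k'"
    "\<And>m. m \<in> {1..d} \<Longrightarrow> F m \<in> carrier_mat (\<rho> (m - 1)) (\<rho> m)" "s \<in> {1..d}"
  shows "prod_upto A F (s - 1) * F s * prod_after F s d E = prod_upto A F d * E"
proof -
  obtain s' where s': "s = Suc s'" using assms(4) by (cases s) auto
  show ?thesis using prod_upto_after[OF assms(1-3), of s] assms(4) by (simp add: s')
qed

lemma trainD: "train \<rho> d X \<Longrightarrow> m \<in> {1..d} \<Longrightarrow> X m \<in> carrier_mat (\<rho> (m - 1)) (\<rho> m)"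
  by (simp add: train_def)

lemma train_upd: "train \<rho> d X \<Longrightarrow> Y \<in> carrier_mat (\<rho> (s - 1)) (\<rho> s) \<Longrightarrow> train \<rho> d (X(s := Y))"
  by (auto simp: train_def)

lemma train_prod_upto_carrier:
  "train \<rho> d X \<Longrightarrow> s \<le> d \<Longrightarrow> prod_upto (1\<^sub>m 1) X s \<in> carrier_mat 1 (\<rho> s)"
  by (intro prod_upto_carrier) (auto simp: train_def)

lemma smult_smult_mat: "a \<cdot>\<^sub>m (b \<cdot>\<^sub>m A) = (a * b :: real) \<cdot>\<^sub>m A"
  by (rule eq_matI) auto

lemma mat_mult_3_entry:
  fixes A B C :: "real mat"
  assumes "A \<in> carrier_mat k m" "B \<in> carrier_mat m n" "C \<in> carrier_mat n l" "i < k" "j < l"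
  shows "(A * B * C) $$ (i, j) = (\<Sum>a<m. \<Sum>b<n. A $$ (i, a) * C $$ (b, j) * B $$ (a, b))"
proof -
  have "A * B \<in> carrier_mat k n" using assms by simp
  then have "(A * B * C) $$ (i, j) = (\<Sum>b<n. (A * B) $$ (i, b) * C $$ (b, j))"
    using assms by (simp add: scalar_prod_def lessThan_atLeast0 del: assoc_mult_mat)
  also have "\<dots> = (\<Sum>b<n. \<Sum>a<m. A $$ (i, a) * C $$ (b, j) * B $$ (a, b))"
    using assms by (auto intro!: sum.cong simp: scalar_prod_def lessThan_atLeast0 sum_distrib_left algebra_simps)
  finally show ?thesis by (subst sum.swap) simp
qed

section \<open>Multilinearity of the value of a train\<close>

lemma tt_val_slot_mult:
  assumes "train \<rho> d X" "s \<in> {1..d}"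
  shows "tt_val d X = (prod_upto (1\<^sub>m 1) X (s - 1) * X s * prod_after X s d (1\<^sub>m 1)) $$ (0, 0)"
proof -
  have "prod_upto (1\<^sub>m 1) X d \<in> carrier_mat 1 (\<rho> d)"
    using assms by (intro prod_upto_carrier) (auto simp: train_def)
  then have "prod_upto (1\<^sub>m 1) X d * 1\<^sub>m 1 = prod_upto (1\<^sub>m 1) X d"
    using assms by (simp add: train_def)
  then show ?thesis
    using prod_split_slot[of "1\<^sub>m 1" 1 \<rho> "1\<^sub>m 1" d 1 X s] assms by (simp add: train_def tt_val_def)
qed

lemma tt_val_slot:
  assumes "train \<rho> d X" "s \<in> {1..d}"
  shows "tt_val d X = (\<Sum>i<\<rho> (s - 1). \<Sum>j<\<rho> s. slot_coeff d X s i j * X s $$ (i, j))"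
proof -
  have "prod_upto (1\<^sub>m 1) X (s - 1) \<in> carrier_mat 1 (\<rho> (s - 1))"
    using assms by (intro prod_upto_carrier) (auto simp: train_def)
  moreover have "prod_after X s d (1\<^sub>m 1) \<in> carrier_mat (\<rho> s) 1"
    using assms by (intro prod_after_carrier) (auto simp: train_def)
  ultimately show ?thesis
    unfolding tt_val_slot_mult[OF assms] slot_coeff_def
    by (intro mat_mult_3_entry trainD[OF assms]) auto
qed

lemma slot_coeff_cong:
  assumes "\<And>m. m \<in> {1..d} \<Longrightarrow> m \<noteq> s \<Longrightarrow> X m = Y m" "s \<in> {1..d}"
  shows "slot_coeff d X s i j = slot_coeff d Y s i j"
proof -
  have "prod_upto (1\<^sub>m 1) X (s - 1) = prod_upto (1\<^sub>m 1) Y (s - 1)"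
    using assms by (intro prod_upto_cong) auto
  moreover have "prod_after X s d (1\<^sub>m 1) = prod_after Y s d (1\<^sub>m 1)"
    using assms by (intro prod_after_cong) auto
  ultimately show ?thesis by (simp add: slot_coeff_def)
qed

text \<open>Slot coefficients ignore slot \<open>s\<close>, so those of the unmodified train can be
  used: the value is a fixed linear functional of the inserted core. The lemmas on sums, scalars,
  zero cores and derivatives all rest on this.\<close>

lemma tt_val_upd:
  assumes "train \<rho> d X" "s \<in> {1..d}" "Y \<in> carrier_mat (\<rho> (s - 1)) (\<rho> s)"
  shows "tt_val d (X(s := Y)) = (\<Sum>i<\<rho> (s - 1). \<Sum>j<\<rho> s. slot_coeff d X s i j * Y $$ (i, j))"
proof -
  have "slot_coeff d (X(s := Y)) s i j = slot_coeff d X s i j" for i j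
    using assms by (intro slot_coeff_cong) auto
  then show ?thesis using tt_val_slot[OF train_upd[OF assms(1,3)] assms(2)] by simp
qed

lemma tt_val_cong: "(\<And>m. m \<in> {1..d} \<Longrightarrow> X m = Y m) \<Longrightarrow> tt_val d X = tt_val d Y"
  unfolding tt_val_def by (subst prod_upto_cong[of d X Y]) auto

text \<open>The combination is given entry by entry, so that cores assembled in different ways can
  be compared without matrix algebra.\<close>

lemma tt_val_upd_add:
  assumes "train \<rho> d X" "s \<in> {1..d}" "Y \<in> carrier_mat (\<rho> (s - 1)) (\<rho> s)" "Z \<in> carrier_mat (\<rho> (s - 1)) (\<rho> s)"
    "W \<in> carrier_mat (\<rho> (s - 1)) (\<rho> s)"
    "\<And>i j. i < \<rho> (s - 1) \<Longrightarrow> j < \<rho> s \<Longrightarrow> W $$ (i, j) = a * Y $$ (i, j) + b * Z $$ (i, j)"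
  shows "tt_val d (X(s := W)) = a * tt_val d (X(s := Y)) + b * tt_val d (X(s := Z))"
proof -
  have "(\<Sum>i<\<rho> (s - 1). \<Sum>j<\<rho> s. slot_coeff d X s i j * W $$ (i, j))
      = (\<Sum>i<\<rho> (s - 1). \<Sum>j<\<rho> s. a * (slot_coeff d X s i j * Y $$ (i, j)) + b * (slot_coeff d X s i j * Z $$ (i, j)))"
    by (intro sum.cong refl) (simp add: assms(6) algebra_simps)
  then show ?thesis
    unfolding tt_val_upd[OF assms(1,2,3)] tt_val_upd[OF assms(1,2,4)] tt_val_upd[OF assms(1,2,5)]
    by (simp add: sum_distrib_left sum.distrib)
qed

lemma tt_val_upd_scale:
  assumes "train \<rho> d X" "s \<in> {1..d}" "Y \<in> carrier_mat (\<rho> (s - 1)) (\<rho> s)"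
  shows "tt_val d (X(s := a \<cdot>\<^sub>m Y)) = a * tt_val d (X(s := Y))"
  using tt_val_upd_add[OF assms(1,2,3,3) _, of "a \<cdot>\<^sub>m Y" a 0] assms(3) by auto

lemma tt_val_upd_zero:
  assumes "train \<rho> d X" "s \<in> {1..d}"
  shows "tt_val d (X(s := 0\<^sub>m (\<rho> (s - 1)) (\<rho> s))) = 0"
  using tt_val_upd_add[OF assms zero_carrier_mat zero_carrier_mat zero_carrier_mat, of 0 0] by simp

text \<open>Collects the univariate factors of a separable term, one from each core, into their
  product.\<close>

lemma tt_val_smult:
  assumes "train \<rho> d X"
  shows "tt_val d (\<lambda>m. c m \<cdot>\<^sub>m X m) = (\<Prod>m=1..d. c m) * tt_val d X"
proof -
  have "prod_upto (1\<^sub>m 1) (\<lambda>m. c m \<cdot>\<^sub>m X m) s = (\<Prod>m=1..s. c m) \<cdot>\<^sub>m prod_upto (1\<^sub>m 1) X s"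
    if "s \<le> d" for s
    using that
  proof (induction s)
    case (Suc s)
    have "prod_upto (1\<^sub>m 1) X s \<in> carrier_mat 1 (\<rho> s)"
      using assms Suc.prems by (intro prod_upto_carrier) (auto simp: train_def)
    moreover have "X (Suc s) \<in> carrier_mat (\<rho> s) (\<rho> (Suc s))" using trainD[OF assms, of "Suc s"] Suc.prems by simp
    ultimately have "((\<Prod>m=1..s. c m) \<cdot>\<^sub>m prod_upto (1\<^sub>m 1) X s) * (c (Suc s) \<cdot>\<^sub>m X (Suc s))
        = (c (Suc s) * (\<Prod>m=1..s. c m)) \<cdot>\<^sub>m (prod_upto (1\<^sub>m 1) X s * X (Suc s))"
      by (simp add: mult_smult_assoc_mat[of _ 1 "\<rho> s" _ "\<rho> (Suc s)"] mult_smult_distrib[of _ 1 "\<rho> s" _ "\<rho> (Suc s)"] smult_smult_mat mult_ac)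
    then show ?case using Suc by (simp add: mult_ac)
  qed (auto simp: smult_mat_def)
  moreover have "prod_upto (1\<^sub>m 1) X d \<in> carrier_mat 1 (\<rho> d)" "\<rho> d = 1"
    using assms train_prod_upto_carrier[OF assms(1) order.refl] by (auto simp: train_def)
  ultimately show ?thesis by (simp add: tt_val_def)
qed

text \<open>Only one slot moves, so a fixed linear functional is differentiated entrywise. It is
  applied to coordinates, to parameters and to the coefficient train.\<close>

lemma has_real_derivative_tt_val:
  assumes "\<And>u. train \<rho> d (X(s := F u))" "s \<in> {1..d}" "train \<rho> d (X(s := F'))"
    "\<And>i j. i < \<rho> (s - 1) \<Longrightarrow> j < \<rho> s \<Longrightarrow> ((\<lambda>u. F u $$ (i, j)) has_real_derivative F' $$ (i, j)) (at u)"
  shows "((\<lambda>u. tt_val d (X(s := F u))) has_real_derivative tt_val d (X(s := F'))) (at u)"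
proof -
  \<comment> \<open>\<open>X\<close> alone is not assumed to be a train, since its slot
    \<open>s\<close> is arbitrary; the functional is therefore read off from
    \<open>X(s := F')\<close>.\<close>
  have *: "tt_val d (X(s := Y)) = (\<Sum>i<\<rho> (s - 1). \<Sum>j<\<rho> s. slot_coeff d (X(s := F')) s i j * Y $$ (i, j))"
    if "train \<rho> d (X(s := Y))" for Y
    using tt_val_upd[OF assms(3,2), of Y] trainD[OF that assms(2)] by simp
  show ?thesis unfolding *[OF assms(1)] *[OF assms(3)]
    by (intro DERIV_sum DERIV_cmult assms(4)) auto
qed

section \<open>Expansion of a core in unit matrices\<close>

lemma unit_mat_carrier: "unit_mat r s a \<in> carrier_mat (r (s - 1)) (r s)"
  by (simp add: unit_mat_def)

text \<open>Undoes the lexicographic flattening of a pair. It is needed for Kronecker indices, for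
  rank pairs, and for columns that combine a grid index with a rank pair.\<close>

lemma sum_div_mod:
  fixes f :: "nat \<Rightarrow> nat \<Rightarrow> real"
  shows "(\<Sum>c<m * n. f (c div n) (c mod n)) = (\<Sum>i<m. \<Sum>j<n. f i j)"
proof -
  have "(\<Sum>c<m * n. f (c div n) (c mod n)) = (\<Sum>i<m. \<Sum>c=i*n..<i*n+n. f (c div n) (c mod n))"
    by (rule sum.nat_group[symmetric])
  also have "\<dots> = (\<Sum>i<m. \<Sum>j<n. f i j)"
  proof (rule sum.cong[OF refl])
    fix i
    have "(\<Sum>c=i*n..<i*n+n. f (c div n) (c mod n)) = (\<Sum>j=0..<n. f ((j + i*n) div n) ((j + i*n) mod n))"
      using sum.shift_bounds_nat_ivl[of "\<lambda>c. f (c div n) (c mod n)" 0 "i*n" n] by (simp add: add.commute)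
    also have "\<dots> = (\<Sum>j<n. f i j)" by (auto intro: sum.cong simp: lessThan_atLeast0)
    finally show "(\<Sum>c=i*n..<i*n+n. f (c div n) (c mod n)) = (\<Sum>j<n. f i j)" .
  qed
  finally show ?thesis .
qed

text \<open>Inserting a unit matrix returns exactly one slot coefficient, so the left side is the
  linear functional of \<open>tt_val_upd\<close> evaluated at \<open>Y\<close>.\<close>

lemma tt_val_unit_expansion:
  assumes "train r d X" "s \<in> {1..d}" "Y \<in> carrier_mat (r (s - 1)) (r s)"
  shows "(\<Sum>a<rank_prod r s. tt_val d (X(s := unit_mat r s a)) * Y $$ (a div r s, a mod r s)) = tt_val d (X(s := Y))"
proof -
  let ?c = "slot_coeff d X s"
  have "tt_val d (X(s := unit_mat r s a)) = ?c (a div r s) (a mod r s)" if "a < rank_prod r s" for a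
  proof -
    \<comment> \<open>The existence of an index \<open>a\<close> in range excludes rank 0, so the
      remainder modulo \<open>r s\<close> is a valid column.\<close>
    have "0 < r s" using that by (cases "r s = 0") (auto simp: rank_prod_def)
    have lt: "a div r s < r (s - 1)" using that by (auto simp: rank_prod_def less_mult_imp_div_less)
    have "tt_val d (X(s := unit_mat r s a))
        = (\<Sum>i<r (s - 1). \<Sum>j<r s. if i = a div r s then if j = a mod r s then ?c i j else 0 else 0)"
      unfolding tt_val_upd[OF assms(1,2) unit_mat_carrier]
      by (intro sum.cong refl) (auto simp: unit_mat_def)
    also have "\<dots> = (\<Sum>i<r (s - 1). if i = a div r s then (\<Sum>j<r s. if j = a mod r s then ?c i j else 0) else 0)"
      by (intro sum.cong refl) auto
    also have "\<dots> = ?c (a div r s) (a mod r s)"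
      using lt \<open>0 < r s\<close> by (simp add: sum.delta)
    finally show ?thesis .
  qed
  then show ?thesis
    unfolding tt_val_upd[OF assms] rank_prod_def
    using sum_div_mod[of "\<lambda>i j. ?c i j * Y $$ (i, j)" "r s" "r (s - 1)"] by simp
qed

section \<open>Kronecker products\<close>

lemma kron_dim [simp]:
  "dim_row (kron A B) = dim_row A * dim_row B" "dim_col (kron A B) = dim_col A * dim_col B"
  by (simp_all add: kron_def)

lemma kron_carrier [intro]:
  "A \<in> carrier_mat a b \<Longrightarrow> B \<in> carrier_mat a' b' \<Longrightarrow> kron A B \<in> carrier_mat (a * a') (b * b')"
  by (rule carrier_matI) auto

text \<open>The mixed-product rule: the summation index splits into quotient and remainder, and the
  double sum factors.\<close>

lemma kron_mult:
  assumes "A \<in> carrier_mat a b" "B \<in> carrier_mat a' b'" "C \<in> carrier_mat b c" "D \<in> carrier_mat b' c'"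
  shows "kron A B * kron C D = kron (A * C) (B * D)"
proof (rule eq_matI)
  fix i j assume "i < dim_row (kron (A * C) (B * D))" "j < dim_col (kron (A * C) (B * D))"
  then have ij: "i < a * a'" "j < c * c'" using assms by auto
  have pos: "0 < a'" using ij(1) by (cases "a' = 0") simp_all
  have pos': "0 < c'" using ij(2) by (cases "c' = 0") simp_all
  have lt: "i div a' < a" "j div c' < c" "i mod a' < a'" "j mod c' < c'"
    using ij pos pos' by (simp_all add: less_mult_imp_div_less)
  have "(kron A B * kron C D) $$ (i, j)
      = (\<Sum>k<b * b'. (A $$ (i div a', k div b') * C $$ (k div b', j div c')) * (B $$ (i mod a', k mod b') * D $$ (k mod b', j mod c')))"
    using assms ij lt by (simp add: kron_def scalar_prod_def lessThan_atLeast0 ac_simps)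
  also have "\<dots> = (\<Sum>k<b. \<Sum>k'<b'. (A $$ (i div a', k) * C $$ (k, j div c')) * (B $$ (i mod a', k') * D $$ (k', j mod c')))"
    by (rule sum_div_mod[where f = "\<lambda>k k'. (A $$ (i div a', k) * C $$ (k, j div c')) * (B $$ (i mod a', k') * D $$ (k', j mod c'))"])
  also have "\<dots> = (A * C) $$ (i div a', j div c') * (B * D) $$ (i mod a', j mod c')"
    using assms lt by (simp add: scalar_prod_def lessThan_atLeast0[symmetric] sum_product)
  finally show "(kron A B * kron C D) $$ (i, j) = kron (A * C) (B * D) $$ (i, j)"
    using assms ij by (simp add: kron_def)
qed (use assms in \<open>auto simp: kron_def\<close>)

lemma tt_val_kron:
  assumes "train \<rho> d X" "train r d Y"
  shows "tt_val d (\<lambda>m. kron (X m) (Y m)) = tt_val d X * tt_val d Y"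
proof -
  have "prod_upto (1\<^sub>m 1) (\<lambda>m. kron (X m) (Y m)) s
      = kron (prod_upto (1\<^sub>m 1) X s) (prod_upto (1\<^sub>m 1) Y s)"
    if "s \<le> d" for s
    using that
  proof (induction s)
    case (Suc s)
    have "prod_upto (1\<^sub>m 1) X s \<in> carrier_mat 1 (\<rho> s)" "prod_upto (1\<^sub>m 1) Y s \<in> carrier_mat 1 (r s)"
      using assms Suc.prems by (auto intro!: prod_upto_carrier simp: train_def)
    moreover have "X (Suc s) \<in> carrier_mat (\<rho> s) (\<rho> (Suc s))" "Y (Suc s) \<in> carrier_mat (r s) (r (Suc s))"
      using trainD[OF assms(1), of "Suc s"] trainD[OF assms(2), of "Suc s"] Suc.prems by auto
    ultimately show ?case using Suc by (simp add: kron_mult)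
  qed (simp, rule eq_matI, auto simp: kron_def)
  moreover have "prod_upto (1\<^sub>m 1) X d \<in> carrier_mat 1 (\<rho> d)" "prod_upto (1\<^sub>m 1) Y d \<in> carrier_mat 1 (r d)"
    "\<rho> d = 1" "r d = 1"
    using assms train_prod_upto_carrier[OF assms(1) order.refl] train_prod_upto_carrier[OF assms(2) order.refl] by (auto simp: train_def)
  ultimately show ?thesis by (simp add: tt_val_def kron_def)
qed

lemma train_kron: "train \<rho> d X \<Longrightarrow> train r d Y \<Longrightarrow> train (\<lambda>m. \<rho> m * r m) d (\<lambda>m. kron (X m) (Y m))"
  by (auto simp: train_def)

section \<open>Block trains\<close>

text \<open>The common shape of \<open>block_core\<close> and of \<open>P_mat\<close> in every
  channel. Channels 1 and 2 fit in because the diagonal block may be zero.\<close>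

definition dual_block :: "real mat \<Rightarrow> real mat \<Rightarrow> real mat" where
  "dual_block A B = four_block_mat A B (0\<^sub>m (dim_row A) (dim_col A)) A"

lemma dual_block_carrier:
  "A \<in> carrier_mat k l \<Longrightarrow> B \<in> carrier_mat k l \<Longrightarrow> dual_block A B \<in> carrier_mat (2 * k) (2 * l)"
  by (rule carrier_matI) (auto simp: dual_block_def)

text \<open>The blocks multiply like dual numbers, so the off-diagonal block of the product obeys the Leibniz rule.\<close>

lemma tt_val_dual_block:
  assumes a: "train \<rho> d a" and b: "\<And>m. m \<in> {1..d} \<Longrightarrow> b m \<in> carrier_mat (\<rho> (m - 1)) (\<rho> m)"
  shows "(prod_upto (mat_of_rows_list 2 [[1, 0]]) (\<lambda>m. dual_block (a m) (b m)) d * mat_of_rows_list 1 [[0], [1]]) $$ (0, 0)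
    = (\<Sum>q=1..d. tt_val d (a(q := b q)))"
proof -
  define pr where "pr X s = prod_upto (1\<^sub>m 1) X s" for X :: "nat \<Rightarrow> real mat" and s
  \<comment> \<open>The candidate for the off-diagonal block of the partial product, already in
    Leibniz form.\<close>
  define R where "R s = mat 1 (\<rho> s) (\<lambda>(i, j). \<Sum>q=1..s. pr (a(q := b q)) s $$ (0, j))" for s
  have car: "pr X s \<in> carrier_mat 1 (\<rho> s)" if "train \<rho> d X" "s \<le> d" for X s
    unfolding pr_def using that by (intro prod_upto_carrier) (auto simp: train_def)
  have ab: "train \<rho> d (a(q := b q))" for q using a b by (auto simp: train_def)
  \<comment> \<open>The vector \<open>[1 0]\<close> on the left leaves a single block row, written
    as a four-block matrix whose lower blocks have zero rows so that block multiplication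
    applies.\<close>
  have blk: "prod_upto (mat_of_rows_list 2 [[1, 0]]) (\<lambda>m. dual_block (a m) (b m)) s
      = four_block_mat (pr a s) (R s) (0\<^sub>m 0 (\<rho> s)) (0\<^sub>m 0 (\<rho> s))"
    if "s \<le> d" for s
    using that
  proof (induction s)
    case 0
    then show ?case using a by (auto simp: pr_def R_def mat_of_rows_list_def train_def less_2_cases_iff nth_Cons' intro!: eq_matI)
  next
    case (Suc s)
    have aS: "a (Suc s) \<in> carrier_mat (\<rho> s) (\<rho> (Suc s))" and bS: "b (Suc s) \<in> carrier_mat (\<rho> s) (\<rho> (Suc s))"
      using trainD[OF a, of "Suc s"] b[of "Suc s"] Suc.prems by auto
    have prS: "pr X (Suc s) = pr X s * X (Suc s)" for X by (simp add: pr_def)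
    have pa: "pr a s \<in> carrier_mat 1 (\<rho> s)" using car[OF a] Suc.prems by simp
    have Rc: "R s \<in> carrier_mat 1 (\<rho> s)" by (simp add: R_def)
    \<comment> \<open>Leibniz recursion: the earlier terms are multiplied by the next
      \<open>a\<close>, and the new term places \<open>b\<close> in the last slot.\<close>
    have RS: "R (Suc s) = pr a s * b (Suc s) + R s * a (Suc s)"
    proof (rule eq_matI)
      fix i j assume "i < dim_row (pr a s * b (Suc s) + R s * a (Suc s))" "j < dim_col (pr a s * b (Suc s) + R s * a (Suc s))"
      then have ij: "i = 0" "j < \<rho> (Suc s)" using aS by (auto simp: R_def)
      have old: "pr (a(q := b q)) (Suc s) = pr (a(q := b q)) s * a (Suc s)" if "q \<in> {1..s}" for q
        using that prS[of "a(q := b q)"] by auto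
      have new: "pr (a(Suc s := b (Suc s))) (Suc s) = pr a s * b (Suc s)"
      proof -
        have "pr (a(Suc s := b (Suc s))) s = pr a s"
          unfolding pr_def by (intro prod_upto_cong) auto
        then show ?thesis by (simp add: prS)
      qed
      have "(\<Sum>q=1..s. pr (a(q := b q)) (Suc s) $$ (0, j)) = (\<Sum>q=1..s. \<Sum>k<\<rho> s. pr (a(q := b q)) s $$ (0, k) * a (Suc s) $$ (k, j))"
      proof (intro sum.cong refl)
        fix q assume q: "q \<in> {1..s}"
        have "pr (a(q := b q)) s \<in> carrier_mat 1 (\<rho> s)" using car[OF ab] Suc.prems by simp
        then show "pr (a(q := b q)) (Suc s) $$ (0, j) = (\<Sum>k<\<rho> s. pr (a(q := b q)) s $$ (0, k) * a (Suc s) $$ (k, j))"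
          using aS ij unfolding old[OF q] by (simp add: scalar_prod_def lessThan_atLeast0)
      qed
      also have "\<dots> = (\<Sum>k<\<rho> s. (\<Sum>q=1..s. pr (a(q := b q)) s $$ (0, k)) * a (Suc s) $$ (k, j))"
        by (subst sum.swap) (simp add: sum_distrib_right)
      also have "\<dots> = (R s * a (Suc s)) $$ (0, j)"
        using aS ij by (simp add: R_def scalar_prod_def lessThan_atLeast0)
      finally have "(\<Sum>q=1..s. pr (a(q := b q)) (Suc s) $$ (0, j)) = (R s * a (Suc s)) $$ (0, j)" .
      moreover have "R (Suc s) $$ (i, j) = (\<Sum>q=1..s. pr (a(q := b q)) (Suc s) $$ (0, j)) + pr (a(Suc s := b (Suc s))) (Suc s) $$ (0, j)"
        using ij by (simp add: R_def)
      ultimately show "R (Suc s) $$ (i, j) = (pr a s * b (Suc s) + R s * a (Suc s)) $$ (i, j)"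
        using ij aS bS pa Rc by (simp add: new)
    qed (use aS in \<open>auto simp: R_def\<close>)
    have "four_block_mat (pr a s) (R s) (0\<^sub>m 0 (\<rho> s)) (0\<^sub>m 0 (\<rho> s)) * dual_block (a (Suc s)) (b (Suc s))
       = four_block_mat (pr a s * a (Suc s)) (pr a s * b (Suc s) + R s * a (Suc s)) (0\<^sub>m 0 (\<rho> (Suc s))) (0\<^sub>m 0 (\<rho> (Suc s)))"
      unfolding dual_block_def using aS bS pa Rc
      by (subst mult_four_block_mat) auto
    then show ?case using Suc by (simp add: RS prS)
  qed
  have "\<rho> d = 1" using a by (simp add: train_def)
  then show ?thesis
    unfolding blk[OF order.refl] tt_val_def
    using car[OF a order.refl] car[OF ab order.refl]
    by (simp add: R_def mat_of_rows_list_def scalar_prod_def pr_def)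
qed

section \<open>The coefficient\<close>

text \<open>The interior rank is 3 because the coefficient is a quadratic polynomial; the three
  states are its degrees 0, 1, 2.\<close>

definition crank :: "nat \<Rightarrow> nat \<Rightarrow> nat" where
  "crank d m = (if m = 0 \<or> m = d then 1 else 3)"

definition in_box :: "nat \<Rightarrow> nat \<Rightarrow> (nat \<Rightarrow> real) \<Rightarrow> bool" where
  "in_box dx d z \<longleftrightarrow> (\<forall>m\<in>{1..d}. z m \<in> Dom dx m)"

definition coords :: "(nat \<Rightarrow> real \<Rightarrow> real mat) \<Rightarrow> (nat \<Rightarrow> real) \<Rightarrow> nat \<Rightarrow> real mat" where
  "coords F z = (\<lambda>m. F m (z m))"

lemma open_Dom: "open (Dom dx m)"
  by (simp add: Dom_def)

lemma in_box_upd: "in_box dx d z \<Longrightarrow> t \<in> Dom dx q \<Longrightarrow> in_box dx d (z(q := t))"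
  by (simp add: in_box_def)

lemma mat_deriv_dim [simp]: "dim_row (mat_deriv F x) = dim_row (F x)" "dim_col (mat_deriv F x) = dim_col (F x)"
  by (simp_all add: mat_deriv_def)

lemma mat_deriv_carrier: "F x \<in> carrier_mat a b \<Longrightarrow> mat_deriv F x \<in> carrier_mat a b"
  by (intro carrier_matI) auto

lemma mat_deriv_index:
  "F x \<in> carrier_mat a b \<Longrightarrow> i < a \<Longrightarrow> j < b \<Longrightarrow> mat_deriv F x $$ (i, j) = deriv (\<lambda>t. F t $$ (i, j)) x"
  by (auto simp: mat_deriv_def)

lemma coords_upd: "coords F (z(q := t)) = (coords F z)(q := F q t)"
  by (auto simp: coords_def)

section \<open>Partial products of the coefficient cores\<close>

lemma K_core_carrier [simp]: "K_core x \<in> carrier_mat 3 3"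
  and M_core_carrier [simp]: "M_core dxi j y \<in> carrier_mat 3 3"
  by (auto simp: K_core_def M_core_def mat_of_rows_list_def Let_def intro!: carrier_matI)

lemma K_core_dim [simp]: "dim_row (K_core x) = 3" "dim_col (K_core x) = 3"
  and M_core_dim [simp]: "dim_row (M_core dxi j y) = 3" "dim_col (M_core dxi j y) = 3"
  by (auto simp: K_core_def M_core_def mat_of_rows_list_def Let_def)

lemma C_core_carrier:
  assumes "1 \<le> dx" "1 \<le> dxi" "m \<in> {1..dx+dxi}"
  shows "C_core dx dxi m t \<in> carrier_mat (crank (dx+dxi) (m - 1)) (crank (dx+dxi) m)"
proof -
  have "mat_of_rows_list 3 [[1, 2 * eps, eps\<^sup>2]] * K_core t \<in> carrier_mat 1 3"
    by (rule mult_carrier_mat[of _ _ 3]) (auto simp: mat_of_rows_list_def intro!: carrier_matI)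
  moreover have "M_core dxi dxi t * mat_of_rows_list 1 [[1], [0], [0]] \<in> carrier_mat 3 1"
    by (rule mult_carrier_mat[of _ _ 3]) (auto simp: mat_of_rows_list_def intro!: carrier_matI)
  ultimately show ?thesis using assms by (auto simp: C_core_def crank_def)
qed

lemma train_C_core:
  "1 \<le> dx \<Longrightarrow> 1 \<le> dxi \<Longrightarrow> train (crank (dx+dxi)) (dx+dxi) (coords (C_core dx dxi) z)"
  using C_core_carrier by (auto simp: train_def coords_def crank_def)

lemma less_3_cases: "(j::nat) < 3 \<Longrightarrow> j = 0 \<or> j = 1 \<or> j = 2"
  by auto

lemma row3_mult:
  fixes X Y :: "real mat"
  assumes "dim_col X = 3" "dim_row Y = 3" "i < dim_row X" "j < dim_col Y"
  shows "(X * Y) $$ (i, j) = X $$ (i, 0) * Y $$ (0, j) + X $$ (i, 1) * Y $$ (1, j) + X $$ (i, 2) * Y $$ (2, j)"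
  using assms by (simp add: scalar_prod_def eval_nat_numeral)

lemma mat_of_rows_list_dim [simp]:
  "dim_row (mat_of_rows_list nc rs) = length rs" "dim_col (mat_of_rows_list nc rs) = nc"
  by (simp_all add: mat_of_rows_list_def)

lemma mat_of_rows_list_index [simp]:
  "i < length rs \<Longrightarrow> j < nc \<Longrightarrow> mat_of_rows_list nc rs $$ (i, j) = rs ! i ! j"
  by (simp add: mat_of_rows_list_def)

lemma M_core_index:
  assumes "i < 3" "j < 3"
  shows "M_core dxi k y $$ (i, j) =
    (let \<sigma> = wgt dxi k * y in [[1, 0, 0], [\<sigma>, 1, 0], [\<sigma>\<^sup>2, 2 * \<sigma>, 1]] ! i ! j)"
  using assms by (simp add: M_core_def Let_def)

lemma K_core_index:
  assumes "i < 3" "j < 3"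
  shows "K_core x $$ (i, j) = (if i = j then cos (pi * x) ^ i else 0)"
  using less_3_cases[OF assms(1)] less_3_cases[OF assms(2)] by (auto simp: K_core_def)

lemma C_core_first_index: "j < 3 \<Longrightarrow> C_core dx dxi 1 t $$ (0, j) = [1, 2 * eps, eps\<^sup>2] ! j * cos (pi * t) ^ j"
  unfolding C_core_def using less_3_cases[of j]
  by (auto simp: K_core_index row3_mult simp del: index_mult_mat(1))

lemma C_core_last_index:
  assumes "i < 3" "1 \<le> dx" "1 \<le> dxi"
  shows "C_core dx dxi (dx+dxi) t $$ (i, 0) = M_core dxi dxi t $$ (i, 0)"
  using assms by (auto simp: C_core_def row3_mult simp del: index_mult_mat(1))

text \<open>The row lists the coefficients of \<open>(1 + eps * \<psi> * (S + t))^2\<close> as a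
  polynomial in \<open>t\<close>, the part of the weighted sum still to come. A core
  \<open>K_core\<close> scales degree \<open>j\<close> by the power \<open>j\<close> of a cosine,
  which extends \<open>\<psi>\<close>. A core \<open>M_core\<close> performs the substitution of
  \<open>\<sigma> + t\<close> for \<open>t\<close>: its rows are the coefficients of the powers 0,
  1, 2 of \<open>\<sigma> + t\<close>.\<close>

lemma prod_upto_C_core:
  fixes z :: "nat \<Rightarrow> real"
  assumes "1 \<le> dx" "1 \<le> dxi" "1 \<le> m" "m < dx + dxi"
  defines "\<psi> \<equiv> (\<lambda>m. \<Prod>i=1..min m dx. cos (pi * z i))"
    and "S \<equiv> (\<lambda>m. \<Sum>j=1..m - dx. wgt dxi j * z (dx + j))"
  shows "prod_upto (1\<^sub>m 1) (coords (C_core dx dxi) z) m =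
    mat_of_rows_list 3 [[(1 + eps * \<psi> m * S m)\<^sup>2, 2 * eps * \<psi> m * (1 + eps * \<psi> m * S m), (eps * \<psi> m)\<^sup>2]]"
  using assms(3,4)
proof (induction m rule: nat_induct_at_least)
  case base
  have "C_core dx dxi 1 (z 1) \<in> carrier_mat 1 3"
    using C_core_carrier[of dx dxi 1 "z 1"] assms(1,2) base by (simp add: crank_def)
  moreover have "\<psi> 1 = cos (pi * z 1)" "S 1 = 0" using assms(1) by (simp_all add: \<psi>_def S_def)
  ultimately show ?case
    by (auto intro!: eq_matI dest!: less_3_cases simp: coords_def C_core_first_index mat_of_rows_list_def power_mult_distrib
        C_core_first_index[of 0, simplified] C_core_first_index[of 1, simplified] C_core_first_index[of 2, simplified])
next
  case (Suc m)
  let ?L = "mat_of_rows_list 3 [[(1 + eps * \<psi> m * S m)\<^sup>2, 2 * eps * \<psi> m * (1 + eps * \<psi> m * S m), (eps * \<psi> m)\<^sup>2]]"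
  have car: "C_core dx dxi (Suc m) (z (Suc m)) \<in> carrier_mat 3 3"
    using C_core_carrier[of dx dxi "Suc m" "z (Suc m)"] assms(1,2) Suc by (simp add: crank_def)
  have IH: "prod_upto (1\<^sub>m 1) (coords (C_core dx dxi) z) (Suc m) = ?L * C_core dx dxi (Suc m) (z (Suc m))"
    using Suc by (simp add: coords_def)
  show ?case
  proof (cases "Suc m \<le> dx")
    case True
    have C: "C_core dx dxi (Suc m) (z (Suc m)) = K_core (z (Suc m))" using True Suc by (simp add: C_core_def)
    \<comment> \<open>Truncated subtraction keeps \<open>S\<close> at 0 among the spatial
      coordinates; likewise \<open>min\<close> freezes \<open>\<psi>\<close> among the parametric
      ones.\<close>
    have *: "\<psi> (Suc m) = \<psi> m * cos (pi * z (Suc m))" "S (Suc m) = 0" "S m = 0"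
      using True by (simp_all add: \<psi>_def S_def min_def)
    show ?thesis unfolding IH
      by (auto intro!: eq_matI dest!: less_3_cases
          simp: C * K_core_index row3_mult power_mult_distrib simp del: index_mult_mat(1))
  next
    case False
    have C: "C_core dx dxi (Suc m) (z (Suc m)) = M_core dxi (Suc m - dx) (z (Suc m))"
      using False Suc by (simp add: C_core_def)
    have *: "\<psi> (Suc m) = \<psi> m" "S (Suc m) = S m + wgt dxi (Suc m - dx) * z (Suc m)"
      using False by (simp_all add: \<psi>_def S_def Suc_diff_le)
    show ?thesis unfolding IH
      by (auto intro!: eq_matI dest!: less_3_cases
          simp: C * M_core_index row3_mult power2_eq_square algebra_simps Let_def simp del: index_mult_mat(1))
  qed
qed

text \<open>The last core performs one more substitution and then keeps the constant coefficient:
  nothing is left to come, so \<open>t = 0\<close>.\<close>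

lemma tt_val_C_core:
  assumes "1 \<le> dx" "1 \<le> dxi"
  shows "tt_val (dx+dxi) (coords (C_core dx dxi) z) = kappa_quad dx dxi z"
proof -
  obtain m where m: "dx + dxi = Suc m" using assms by (cases "dx + dxi") auto
  define S where "S = (\<Sum>j=1..m - dx. wgt dxi j * z (dx + j))"
  have c: "C_core dx dxi (Suc m) (z (Suc m)) \<in> carrier_mat 3 1"
    using C_core_carrier[of dx dxi "Suc m" "z (Suc m)"] assms m by (simp add: crank_def)
  have ix: "C_core dx dxi (Suc m) (z (Suc m)) $$ (i, 0) = M_core dxi dxi (z (Suc m)) $$ (i, 0)" if "i < 3" for i
    using C_core_last_index[OF that assms] m by simp
  have "min m dx = dx" using m assms by auto
  then have p: "prod_upto (1\<^sub>m 1) (coords (C_core dx dxi) z) m = mat_of_rows_list 3 [[(1 + eps * psi dx z * S)\<^sup>2,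
      2 * eps * psi dx z * (1 + eps * psi dx z * S), (eps * psi dx z)\<^sup>2]]"
    using prod_upto_C_core[of dx dxi m z] assms m by (simp add: psi_def S_def)
  have "Suc (m - dx) = dxi" using m assms by auto
  then have "(\<Sum>j=1..dxi. wgt dxi j * z (dx + j)) = S + wgt dxi dxi * z (Suc m)"
    using sum.cl_ivl_Suc[of "\<lambda>j. wgt dxi j * z (dx + j)" 1 "m - dx"] m by (simp add: S_def)
  then have k: "kappa_quad dx dxi z = (1 + eps * psi dx z * (S + wgt dxi dxi * z (Suc m)))\<^sup>2"
    by (simp add: kappa_quad_def)
  show ?thesis unfolding m tt_val_def prod_upto_Suc p k
    using carrier_matD[OF c] by (simp add: coords_def row3_mult ix M_core_index Let_def power2_eq_square algebra_simps
        del: index_mult_mat(1))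
qed

section \<open>Partial derivatives of the coefficient\<close>

lemma C_core_has_derivative:
  assumes "1 \<le> dx" "1 \<le> dxi" "m \<in> {1..dx}"
    "i < crank (dx+dxi) (m - 1)" "j < crank (dx+dxi) m"
  shows "((\<lambda>t. C_core dx dxi m t $$ (i, j)) has_real_derivative mat_deriv (C_core dx dxi m) t $$ (i, j)) (at t)"
proof -
  have *: "mat_deriv (C_core dx dxi m) t $$ (i, j) = deriv (\<lambda>t. C_core dx dxi m t $$ (i, j)) t"
    using assms by (intro mat_deriv_index[OF C_core_carrier]) auto
  \<comment> \<open>One form covers both the first core, a row, and the later spatial cores, which
    are diagonal; off the diagonal \<open>c = 0\<close>.\<close>
  have "\<exists>c k. (\<lambda>t. C_core dx dxi m t $$ (i, j)) = (\<lambda>t. c * cos (pi * t) ^ k)"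
  proof (cases "m = 1")
    case True
    then have "i = 0" "j < 3" using assms by (auto simp: crank_def split: if_splits)
    then show ?thesis using True C_core_first_index by blast
  next
    case False
    then have ij: "i < 3" "j < 3" using assms by (auto simp: crank_def split: if_splits)
    have "C_core dx dxi m t $$ (i, j) = (if i = j then 1 else 0) * cos (pi * t) ^ i" for t
      using False assms ij by (simp add: C_core_def K_core_index)
    then show ?thesis by blast
  qed
  then obtain c k where "(\<lambda>t. C_core dx dxi m t $$ (i, j)) = (\<lambda>t. c * cos (pi * t) ^ k)" by blast
  moreover have "((\<lambda>t. c * cos (pi * t) ^ k) has_real_derivative c * (k * cos (pi * t) ^ (k - 1) * (- sin (pi * t) * pi))) (at t)"
    by (auto intro!: derivative_eq_intros)
  ultimately have "(\<lambda>t. C_core dx dxi m t $$ (i, j)) field_differentiable at t"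
    by (auto simp: field_differentiable_def)
  then show ?thesis unfolding * by (rule field_differentiable_derivI)
qed

text \<open>Differentiating the train representation keeps the derivative as a train with one
  differentiated core, the form in which the block product produces it.\<close>

lemma kappa_quad_has_derivative:
  assumes "1 \<le> dx" "1 \<le> dxi" "q \<in> {1..dx}"
  shows "((\<lambda>t. kappa_quad dx dxi (z(q := t))) has_real_derivative
    tt_val (dx+dxi) ((coords (C_core dx dxi) z)(q := mat_deriv (C_core dx dxi q) (z q)))) (at (z q))"
proof -
  have "((\<lambda>u. tt_val (dx+dxi) ((coords (C_core dx dxi) z)(q := C_core dx dxi q u))) has_real_derivative
    tt_val (dx+dxi) ((coords (C_core dx dxi) z)(q := mat_deriv (C_core dx dxi q) (z q)))) (at (z q))"
    using assms
    by (intro has_real_derivative_tt_val[of "crank (dx+dxi)"] train_upd train_C_core C_core_has_derivative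
        mat_deriv_carrier C_core_carrier) auto
  then show ?thesis using assms by (simp add: tt_val_C_core[symmetric] coords_upd)
qed

section \<open>Sums over the separable terms\<close>

lemma sum_squared:
  fixes a :: "nat \<Rightarrow> real"
  shows "(\<Sum>j=1..n. a j)\<^sup>2 = (\<Sum>j=1..n. (a j)\<^sup>2) + 2 * (\<Sum>k=1..n. \<Sum>j=1..<k. a j * a k)"
proof (induction n)
  case (Suc n)
  then show ?case
    by (simp add: power2_sum sum_distrib_right[symmetric] atLeastLessThanSuc_atLeastAtMost algebra_simps)
qed simp

text \<open>Distinct constructors make the four families disjoint. Mixed terms are listed with the
  larger index first, to match the iterated sum in \<open>sum_squared\<close>.\<close>

lemma qterms_eq:
  "qterms dxi = insert TOne (TLin ` {1..dxi} \<union> (TSq ` {1..dxi} \<union> (\<lambda>(k, j). TMix j k) ` (SIGMA k:{1..dxi}. {1..<k})))"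
  by (auto simp: qterms_def)

lemma sum_qterms: "(\<Sum>\<tau>\<in>qterms dxi. qterm_fun dx dxi \<tau> z) = kappa_quad dx dxi z"
proof -
  let ?f = "\<lambda>\<tau>. qterm_fun dx dxi \<tau> z" and ?a = "\<lambda>j. wgt dxi j * z (dx + j)"
  let ?M = "(\<lambda>(k, j). TMix j k) ` (SIGMA k:{1..dxi}. {1..<k})"
  have "sum ?f (qterms dxi) = 1 + sum ?f (TLin ` {1..dxi} \<union> (TSq ` {1..dxi} \<union> ?M))"
    unfolding qterms_eq by (subst sum.insert) auto
  also have "sum ?f (TLin ` {1..dxi} \<union> (TSq ` {1..dxi} \<union> ?M))
      = sum ?f (TLin ` {1..dxi}) + (sum ?f (TSq ` {1..dxi}) + sum ?f ?M)"
  proof -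
    have "TLin ` {1..dxi} \<inter> (TSq ` {1..dxi} \<union> ?M) = {}" "TSq ` {1..dxi} \<inter> ?M = {}" by auto
    then show ?thesis by (simp add: sum.union_disjoint)
  qed
  also have "sum ?f (TLin ` {1..dxi}) = 2 * (eps * psi dx z * (\<Sum>j=1..dxi. ?a j))"
    by (simp add: sum.reindex inj_on_def sum_distrib_left mult_ac)
  also have "sum ?f (TSq ` {1..dxi}) = (eps * psi dx z)\<^sup>2 * (\<Sum>j=1..dxi. (?a j)\<^sup>2)"
    by (simp add: sum.reindex inj_on_def sum_distrib_left power_mult_distrib mult_ac)
  also have "sum ?f ?M = (eps * psi dx z)\<^sup>2 * (2 * (\<Sum>k=1..dxi. \<Sum>j=1..<k. ?a j * ?a k))"
  proof -
    have "sum ?f ?M = (\<Sum>(k, j)\<in>(SIGMA k:{1..dxi}. {1..<k}). ?f (TMix j k))"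
      by (subst sum.reindex) (auto simp: inj_on_def case_prod_unfold)
    also have "\<dots> = (\<Sum>k=1..dxi. \<Sum>j=1..<k. ?f (TMix j k))"
      by (rule sum.Sigma[symmetric]) auto
    finally show ?thesis by (simp add: sum_distrib_left power2_eq_square mult_ac)
  qed
  finally have "sum ?f (qterms dxi) = 1 + 2 * (eps * psi dx z * (\<Sum>j=1..dxi. ?a j))
      + (eps * psi dx z)\<^sup>2 * (\<Sum>j=1..dxi. ?a j)\<^sup>2"
    unfolding sum_squared by (simp only: distrib_left add.assoc)
  then show ?thesis unfolding kappa_quad_def power2_sum power_mult_distrib by simp
qed

lemma sum_kappa:
  assumes "separable_factors dx dxi \<kappa>" "in_box dx (dx+dxi) z"
  shows "(\<Sum>\<tau>\<in>qterms dxi. \<Prod>m=1..dx+dxi. \<kappa> \<tau> m (z m)) = kappa_quad dx dxi z"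
  unfolding sum_qterms[of dx dxi z, symmetric]
  using assms by (intro sum.cong) (auto simp: separable_factors_def in_box_def)

text \<open>Both sides are derivatives in coordinate \<open>q\<close> of the same function: the left
  one of the sum of separable products, the right one of the coefficient train.\<close>

lemma sum_deriv_kappa:
  assumes "1 \<le> dx" "1 \<le> dxi" "q \<in> {1..dx}" "separable_factors dx dxi \<kappa>" "in_box dx (dx+dxi) z"
  shows "(\<Sum>\<tau>\<in>qterms dxi. \<Prod>m=1..dx+dxi. if m = q then deriv (\<kappa> \<tau> q) (z q) else \<kappa> \<tau> m (z m))
    = tt_val (dx+dxi) ((coords (C_core dx dxi) z)(q := mat_deriv (C_core dx dxi q) (z q)))"
proof -
  let ?I = "{1..dx+dxi}"
  have q: "q \<in> ?I" and zq: "z q \<in> Dom dx q" using assms by (auto simp: in_box_def)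
  have split: "(\<Prod>m\<in>?I. if m = q then c else \<kappa> \<tau> m (z m)) = c * (\<Prod>m\<in>?I - {q}. \<kappa> \<tau> m (z m))" for c \<tau>
    using q by (subst prod.remove[of _ q]) (auto intro!: prod.cong)
  have "(\<kappa> \<tau> q has_real_derivative deriv (\<kappa> \<tau> q) (z q)) (at (z q))" if "\<tau> \<in> qterms dxi" for \<tau>
  proof -
    have "\<kappa> \<tau> q differentiable_on Dom dx q" using assms that by (auto simp: separable_factors_def)
    then have "\<kappa> \<tau> q differentiable at (z q)"
      using zq open_Dom by (simp add: differentiable_on_eq_differentiable_at)
    then show ?thesis by (simp add: DERIV_deriv_iff_real_differentiable)
  qed
  then have "((\<lambda>t. \<Sum>\<tau>\<in>qterms dxi. \<kappa> \<tau> q t * (\<Prod>m\<in>?I - {q}. \<kappa> \<tau> m (z m))) has_real_derivative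
      (\<Sum>\<tau>\<in>qterms dxi. deriv (\<kappa> \<tau> q) (z q) * (\<Prod>m\<in>?I - {q}. \<kappa> \<tau> m (z m)))) (at (z q))"
    by (intro DERIV_sum DERIV_cmult_right) auto
  \<comment> \<open>The factorization is known only inside the box; since \<open>Dom dx q\<close> is
    open, agreement there suffices to transfer the derivative.\<close>
  moreover have "(\<Sum>\<tau>\<in>qterms dxi. \<kappa> \<tau> q t * (\<Prod>m\<in>?I - {q}. \<kappa> \<tau> m (z m))) = kappa_quad dx dxi (z(q := t))"
    if "t \<in> Dom dx q" for t
    unfolding sum_kappa[OF assms(4) in_box_upd[OF assms(5) that], symmetric] split[symmetric]
    by (intro sum.cong prod.cong) auto
  ultimately have "((\<lambda>t. kappa_quad dx dxi (z(q := t))) has_real_derivative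
      (\<Sum>\<tau>\<in>qterms dxi. deriv (\<kappa> \<tau> q) (z q) * (\<Prod>m\<in>?I - {q}. \<kappa> \<tau> m (z m)))) (at (z q))"
    by (rule has_field_derivative_transform_within_open[OF _ open_Dom zq])
  then show ?thesis
    using kappa_quad_has_derivative[OF assms(1-3), of z] unfolding split by (rule DERIV_unique)
qed

section \<open>Direction matrices\<close>

definition core_train :: "(nat \<Rightarrow> nat) \<Rightarrow> nat \<Rightarrow> (nat \<Rightarrow> real \<Rightarrow> real mat) \<Rightarrow> bool" where
  "core_train r d g \<longleftrightarrow> r 0 = 1 \<and> r d = 1 \<and> (\<forall>m\<in>{1..d}. \<forall>t. g m t \<in> carrier_mat (r (m - 1)) (r m))"

text \<open>For spatial \<open>q\<close>, the partial derivative of \<open>kappa_quad\<close> in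
  coordinate \<open>q\<close>, by \<open>kappa_quad_has_derivative\<close>.\<close>

definition kappa_deriv :: "nat \<Rightarrow> nat \<Rightarrow> nat \<Rightarrow> (nat \<Rightarrow> real) \<Rightarrow> real" where
  "kappa_deriv dx dxi q z = tt_val (dx+dxi) ((coords (C_core dx dxi) z)(q := mat_deriv (C_core dx dxi q) (z q)))"

text \<open>The part of the Darcy operator that channel \<open>l\<close> contributes when \<open>Y\<close> replaces the core in slot \<open>s\<close>.\<close>

definition channel_val ::
  "nat \<Rightarrow> nat \<Rightarrow> (nat \<Rightarrow> real \<Rightarrow> real mat) \<Rightarrow> nat \<Rightarrow> nat \<Rightarrow> (nat \<Rightarrow> real) \<Rightarrow> real mat \<Rightarrow> real" where
  "channel_val dx dxi g s l z Y =
    (if l = 0 then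
       \<Sum>q\<in>{1..dx} - {s}.
         - kappa_deriv dx dxi q z * tt_val (dx+dxi) ((coords g z)(s := Y, q := mat_deriv (g q) (z q)))
         - kappa_quad dx dxi z * tt_val (dx+dxi) ((coords g z)(s := Y, q := mat_deriv (mat_deriv (g q)) (z q)))
     else if l = 1 then - kappa_deriv dx dxi s z * tt_val (dx+dxi) ((coords g z)(s := Y))
     else - kappa_quad dx dxi z * tt_val (dx+dxi) ((coords g z)(s := Y)))"

lemma core_trainD: "core_train r d g \<Longrightarrow> m \<in> {1..d} \<Longrightarrow> g m t \<in> carrier_mat (r (m - 1)) (r m)"
  by (simp add: core_train_def)

lemma train_coords: "core_train r d g \<Longrightarrow> train r d (coords g z)"
  by (simp add: core_train_def train_def coords_def)

lemma mat_deriv2_index: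
  assumes "\<And>t. F t \<in> carrier_mat a b" "i < a" "j < b"
  shows "mat_deriv (mat_deriv F) x $$ (i, j) = (deriv ^^ 2) (\<lambda>t. F t $$ (i, j)) x"
proof -
  have "(\<lambda>t. mat_deriv F t $$ (i, j)) = deriv (\<lambda>t. F t $$ (i, j))"
    using mat_deriv_index[OF assms] by (intro ext)
  then show ?thesis
    using mat_deriv_index[where F = "mat_deriv F" and x = x, OF mat_deriv_carrier[OF assms(1)] assms(2,3)] by (simp add: numeral_2_eq_2)
qed

lemma tt_val_kron_upd:
  assumes "train \<rho> d X" "train r d Y" "U \<in> carrier_mat (\<rho> (q - 1)) (\<rho> q)" "V \<in> carrier_mat (r (q - 1)) (r q)"
  shows "tt_val d ((\<lambda>m. kron (X m) (Y m))(q := kron U V)) = tt_val d (X(q := U)) * tt_val d (Y(q := V))"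
proof -
  have "(\<lambda>m. kron (X m) (Y m))(q := kron U V) = (\<lambda>m. kron ((X(q := U)) m) ((Y(q := V)) m))" by auto
  then show ?thesis using tt_val_kron[OF train_upd[OF assms(1,3)] train_upd[OF assms(2,4)]] by simp
qed

text \<open>With \<open>P_mat\<close> as the dual block in slot \<open>s\<close>, the whole
  expression is one block train, hence a sum over the slot \<open>q\<close> that carries the
  off-diagonal block. Channel 0 has a zero off-diagonal block, which removes \<open>q = s\<close>.
  Channels 1 and 2 have a zero diagonal block, which removes every \<open>q\<close> other than
  \<open>s\<close>.\<close>

lemma Q_P_Q_eq_channel_val:
  assumes "1 \<le> dx" "1 \<le> dxi" and g: "core_train r (dx+dxi) g" and s: "s \<in> {1..dx+dxi}" and l: "l \<in> channels dx s"
  shows "(Q_less dx dxi g s z * P_mat dx dxi r s l a (z s) * Q_greater dx dxi g s z) $$ (0, 0)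
    = channel_val dx dxi g s l z (unit_mat r s a)"
proof -
  define d where "d = dx + dxi"
  define \<rho> where "\<rho> = crank d"
  define M where "M = unit_mat r s a"
  define c where "c = coords (C_core dx dxi) z"
  define x where "x = (coords g z)(s := M)"
  define c' where "c' q = mat_deriv (C_core dx dxi q) (z q)" for q
  define x' where "x' q = mat_deriv (g q) (z q)" for q
  define x'' where "x'' q = mat_deriv (mat_deriv (g q)) (z q)" for q
  define Z where "Z m = (0\<^sub>m (\<rho> (m - 1) * r (m - 1)) (\<rho> m * r m) :: real mat)" for m
  define as where "as = (if l = 0 then kron (c s) M else Z s)"
  define bs where "bs = (if l = 0 then Z s else if l = 1 then - kron (c' s) M else - kron (c s) M)"
  define A where "A = (\<lambda>m. if m = s then as else A_core dx dxi g m (z m))"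
  define B where "B = (\<lambda>m. if m = s then bs else B_core dx dxi g m (z m))"
  \<comment> \<open>The undisturbed Kronecker train with the unit matrix in slot \<open>s\<close>;
    all Leibniz terms are updates of it.\<close>
  define k where "k = (\<lambda>m. kron (c m) (x m))"
  note dims = assms(1,2)
  have s': "s \<in> {1..d}" using s by (simp add: d_def)
  have car_c: "c m \<in> carrier_mat (\<rho> (m - 1)) (\<rho> m)" if "m \<in> {1..d}" for m
    using C_core_carrier[OF dims, of m] that by (simp add: c_def coords_def \<rho>_def d_def)
  have car_c': "c' m \<in> carrier_mat (\<rho> (m - 1)) (\<rho> m)" if "m \<in> {1..d}" for m
    using C_core_carrier[OF dims, of m] that by (auto simp: c'_def \<rho>_def d_def intro: mat_deriv_carrier)
  have car_M: "M \<in> carrier_mat (r (s - 1)) (r s)" unfolding M_def by (rule unit_mat_carrier)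
  have car_g: "g m t \<in> carrier_mat (r (m - 1)) (r m)" if "m \<in> {1..d}" for m t
    using core_trainD[OF g] that by (simp add: d_def)
  have car_x': "x' m \<in> carrier_mat (r (m - 1)) (r m)" "x'' m \<in> carrier_mat (r (m - 1)) (r m)" if "m \<in> {1..d}" for m
    using car_g[OF that] by (auto simp: x'_def x''_def intro!: mat_deriv_carrier)
  have tc: "train \<rho> d c" using train_C_core[OF dims] by (simp add: c_def \<rho>_def d_def)
  have tx: "train r d x" unfolding x_def using train_coords[OF g] car_M by (auto simp: d_def intro: train_upd)
  have tk: "train (\<lambda>m. \<rho> m * r m) d k" unfolding k_def by (rule train_kron[OF tc tx])
  have c_s: "c s = C_core dx dxi s (z s)" and x_s: "x s = M" by (simp_all add: c_def coords_def x_def)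
  have k_ns: "A_core dx dxi g m (z m) = k m" if "m \<noteq> s" for m
    using that by (simp add: A_core_def k_def c_def x_def coords_def)
  have k_s: "k s = kron (c s) M" by (simp add: k_def x_s)
  have car_bs: "bs \<in> carrier_mat (\<rho> (s - 1) * r (s - 1)) (\<rho> s * r s)"
    using car_c[OF s'] car_c'[OF s'] car_M by (auto simp: bs_def Z_def)
  have A_eq: "A = (if l = 0 then k else k(s := Z s))"
    by (auto simp: A_def as_def k_ns k_s)
  have tA: "train (\<lambda>m. \<rho> m * r m) d A"
    unfolding A_eq using tk by (auto intro: train_upd simp: Z_def)
  have B_gt: "B m = Z m" if "m \<in> {1..d}" "m \<noteq> s" "dx < m" for m
    using that trainD[OF tk, of m] by (simp add: B_def B_core_def k_ns Z_def)
  have B_le: "B m = - kron (c' m) (x' m) - kron (c m) (x'' m)" if "m \<noteq> s" "m \<le> dx" for m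
    using that by (simp add: B_def B_core_def c_def coords_def c'_def x'_def x''_def)
  have tB: "B m \<in> carrier_mat (\<rho> (m - 1) * r (m - 1)) (\<rho> m * r m)" if "m \<in> {1..d}" for m
  proof (cases "m = s")
    case True then show ?thesis using car_bs by (simp add: B_def)
  next
    case False
    then show ?thesis
      using B_gt[OF that False] B_le[OF False] car_c[OF that] car_c'[OF that] car_x'[OF that]
      by (cases "m \<le> dx") (auto simp: Z_def)
  qed
  have P: "P_mat dx dxi r s l a (z s) = dual_block (A s) (B s)"
  proof -
    have "dim_row (kron (c s) M) = \<rho> (s - 1) * r (s - 1)" "dim_col (kron (c s) M) = \<rho> s * r s"
      using car_c[OF s'] car_M by auto
    then show ?thesis
      by (simp add: P_mat_def dual_block_def A_def B_def as_def bs_def Z_def Let_def c_s c'_def M_def)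
  qed
  let ?F = "\<lambda>m. dual_block (A m) (B m)"
  have blk: "block_core dx dxi g m (z m) = ?F m" if "m \<noteq> s" for m
    using that by (simp add: block_core_def dual_block_def A_def B_def)
  have Ql: "Q_less dx dxi g s z = prod_upto (mat_of_rows_list 2 [[1, 0]]) ?F (s - 1)"
  proof -
    have "Q_less dx dxi g s z = prod_upto (mat_of_rows_list 2 [[1, 0]]) (\<lambda>m. block_core dx dxi g m (z m)) (s - 1)"
      using s by (simp add: Q_less_def prod_upto_def)
    also have "\<dots> = prod_upto (mat_of_rows_list 2 [[1, 0]]) ?F (s - 1)"
      using s by (intro prod_upto_cong blk) auto
    finally show ?thesis .
  qed
  have Qg: "Q_greater dx dxi g s z = prod_after ?F s d (mat_of_rows_list 1 [[0], [1]])"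
  proof -
    have "Q_greater dx dxi g s z = prod_after (\<lambda>m. block_core dx dxi g m (z m)) s d (mat_of_rows_list 1 [[0], [1]])"
      by (simp add: Q_greater_def prod_after_def d_def)
    also have "\<dots> = prod_after ?F s d (mat_of_rows_list 1 [[0], [1]])"
      using s' by (intro prod_after_cong blk) auto
    finally show ?thesis .
  qed
  have r1: "\<rho> 0 = 1" "\<rho> d = 1" "r 0 = 1" "r d = 1" using tc tx by (auto simp: train_def)
  have "(Q_less dx dxi g s z * P_mat dx dxi r s l a (z s) * Q_greater dx dxi g s z)
     = prod_upto (mat_of_rows_list 2 [[1, 0]]) ?F d * mat_of_rows_list 1 [[0], [1]]"
    unfolding Ql Qg P
  \<comment> \<open>Block cores double the Kronecker ranks, so the two ends have size 2 and match
    the border vectors.\<close>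
  proof (rule prod_split_slot[where k = 1 and k' = 1 and \<rho> = "\<lambda>m. 2 * (\<rho> m * r m)"])
    show "dual_block (A m) (B m) \<in> carrier_mat (2 * (\<rho> (m - 1) * r (m - 1))) (2 * (\<rho> m * r m))" if "m \<in> {1..d}" for m
      using trainD[OF tA that] tB[OF that] by (rule dual_block_carrier)
  qed (use r1 s' in \<open>auto intro!: carrier_matI\<close>)
  then have main: "(Q_less dx dxi g s z * P_mat dx dxi r s l a (z s) * Q_greater dx dxi g s z) $$ (0, 0)
     = (\<Sum>q=1..d. tt_val d (A(q := B q)))"
    using tt_val_dual_block[OF tA tB] unfolding prod_upto_def by simp
  have kq: "tt_val d c = kappa_quad dx dxi z"
    using tt_val_C_core[OF dims] by (simp add: c_def d_def)
  have kd: "tt_val d (c(q := c' q)) = kappa_deriv dx dxi q z" for q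
    by (simp add: kappa_deriv_def c_def c'_def d_def)
  have ku: "tt_val d (k(q := kron U V)) = tt_val d (c(q := U)) * tt_val d (x(q := V))"
    if "U \<in> carrier_mat (\<rho> (q - 1)) (\<rho> q)" "V \<in> carrier_mat (r (q - 1)) (r q)" for q U V
    unfolding k_def by (rule tt_val_kron_upd[OF tc tx that])
  have neg: "tt_val d (k(s := - kron U M)) = - (tt_val d (c(s := U)) * tt_val d x)"
    if "U \<in> carrier_mat (\<rho> (s - 1)) (\<rho> s)" for U
  proof -
    have "- kron U M = (-1) \<cdot>\<^sub>m kron U M" by (rule eq_matI) auto
    then show ?thesis
      using tt_val_upd_scale[OF tk s' kron_carrier[OF that car_M], of "-1"] ku[OF that car_M] x_s
      by (simp add: fun_upd_idem)
  qed
  show ?thesis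
  proof (cases "l = 0")
    case True
    have "tt_val d (A(q := B q)) = (if q \<in> {1..dx} - {s} then
        - kappa_deriv dx dxi q z * tt_val d (x(q := x' q)) - kappa_quad dx dxi z * tt_val d (x(q := x'' q)) else 0)"
      if q: "q \<in> {1..d}" for q
    proof (cases "q \<in> {1..dx} - {s}")
      case qs: True
      have "tt_val d (k(q := B q)) = (-1) * tt_val d (k(q := kron (c' q) (x' q))) + (-1) * tt_val d (k(q := kron (c q) (x'' q)))"
      proof (rule tt_val_upd_add[OF tk q])
        show "B q $$ (i, j) = - 1 * kron (c' q) (x' q) $$ (i, j) + - 1 * kron (c q) (x'' q) $$ (i, j)"
          if "i < \<rho> (q - 1) * r (q - 1)" "j < \<rho> q * r q" for i j
          using B_le[of q] qs that car_c[OF q] car_c'[OF q] car_x'[OF q] by simp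
      qed (use tB[OF q] car_c[OF q] car_c'[OF q] car_x'[OF q] in auto)
      moreover have "c(q := c q) = c" by simp
      ultimately show ?thesis
        using qs True ku[OF car_c'[OF q] car_x'(1)[OF q]] ku[OF car_c[OF q] car_x'(2)[OF q]]
        by (simp add: A_eq kq kd)
    next
      case False
      \<comment> \<open>Two cases vanish: \<open>q = s\<close>, by the form of channel 0, and
        \<open>q > dx\<close>, where nothing is differentiated.\<close>
      then have "B q = Z q" using q B_gt[of q] True by (cases "q = s") (auto simp: B_def bs_def)
      then show ?thesis using False tt_val_upd_zero[OF tA q] by (auto simp: Z_def)
    qed
    then have "(\<Sum>q=1..d. tt_val d (A(q := B q))) = (\<Sum>q=1..d. if q \<in> {1..dx} - {s} then
        - kappa_deriv dx dxi q z * tt_val d (x(q := x' q)) - kappa_quad dx dxi z * tt_val d (x(q := x'' q)) else 0)"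
      by (rule sum.cong[OF refl])
    also have "\<dots> = (\<Sum>q\<in>{1..dx} - {s}. - kappa_deriv dx dxi q z * tt_val d (x(q := x' q)) - kappa_quad dx dxi z * tt_val d (x(q := x'' q)))"
      by (rule sum.mono_neutral_cong_right) (auto simp: d_def)
    finally show ?thesis
      unfolding main using True by (simp add: channel_val_def d_def x_def x'_def x''_def M_def)
  next
    case False
    then have bs: "bs = - kron (if l = 1 then c' s else c s) M" by (auto simp: bs_def)
    have "tt_val d (A(q := B q)) = (if q = s then tt_val d (k(s := bs)) else 0)" if q: "q \<in> {1..d}" for q
    proof (cases "q = s")
      case True then show ?thesis using False by (simp add: A_eq B_def)
    next
      case qs: False
      \<comment> \<open>Slot \<open>s\<close> of \<open>A\<close> is already zero; writing the zero
        again exhibits the vanishing slot as the outermost update.\<close>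
      then have "A(q := B q) = (A(q := B q))(s := Z s)" using False by (auto simp: A_eq)
      moreover have "tt_val d ((A(q := B q))(s := Z s)) = 0"
        unfolding Z_def by (rule tt_val_upd_zero[OF train_upd[OF tA tB[OF q]] s'])
      ultimately show ?thesis using qs by simp
    qed
    then have "(\<Sum>q=1..d. tt_val d (A(q := B q))) = tt_val d (k(s := bs))"
      using s' by simp
    also have "\<dots> = channel_val dx dxi g s l z (unit_mat r s a)"
      using neg[OF car_c[OF s']] neg[OF car_c'[OF s']] False unfolding bs
      by (simp add: channel_val_def kq[unfolded d_def] kd[unfolded d_def] x_def M_def d_def)
    finally show ?thesis unfolding main .
  qed
qed

section \<open>The direction matrices of the general separable operator\<close>

lemma distinct_others: "distinct (others d s)" and set_others: "set (others d s) = {1..d} - {s}"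
  by (auto simp: others_def)

lemma prod_list_upto: "prod_list (map n [1..<d+1]) = (\<Prod>m=1..d. n m)" for n :: "nat \<Rightarrow> nat"
  by (subst prod.distinct_set_conv_list[symmetric]) (auto intro!: prod.cong)

lemma prod_list_others: "prod_list (map n (others d s)) = (\<Prod>m\<in>{1..d} - {s}. n m)" for n :: "nat \<Rightarrow> nat"
  by (subst prod.distinct_set_conv_list[symmetric, OF distinct_others]) (simp add: set_others)

lemma op_factor_mat_dim [simp]:
  "dim_row (op_factor_mat \<kappa> \<tau> q m F t) = dim_row (F t)" "dim_col (op_factor_mat \<kappa> \<tau> q m F t) = dim_col (F t)"
  by (simp_all add: op_factor_mat_def)

lemma op_factor_mat_carrier: "F t \<in> carrier_mat a b \<Longrightarrow> op_factor_mat \<kappa> \<tau> q m F t \<in> carrier_mat a b"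
  by (intro carrier_matI) auto

lemma train_op_factor_mat:
  "core_train r d g \<Longrightarrow> train r d (\<lambda>m. op_factor_mat \<kappa> \<tau> q m (g m) (z m))"
  by (auto simp: core_train_def train_def intro!: op_factor_mat_carrier)

text \<open>Decoding the position recovers the grid indices away from \<open>s\<close>; slot
  \<open>s\<close>, for which no digit is stored, holds the unit matrix.\<close>

lemma E_mat_index:
  assumes g: "core_train r d g" and s: "s \<in> {1..d}" and i: "\<And>m. m \<in> {1..d} \<Longrightarrow> i m < n m" and a: "a < rank_prod r s"
  shows "E_mat d n r pt g \<kappa> s \<tau> q $$ (lex_pos n (others d s) i, a)
    = tt_val d ((\<lambda>m. op_factor_mat \<kappa> \<tau> q m (g m) (pt m (i m)))(s := unit_mat r s a))"
proof -
  let ?F = "\<lambda>m. op_factor_mat \<kappa> \<tau> q m (g m) (pt m (i m))"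
  let ?F' = "\<lambda>m. op_factor_mat \<kappa> \<tau> q m (g m) (pt m (lex_digits n (others d s) (lex_pos n (others d s) i) m))"
  let ?X = "?F(s := unit_mat r s a)"
  have lt: "lex_pos n (others d s) i < (\<Prod>m\<in>{1..d} - {s}. n m)"
    unfolding prod_list_others[symmetric] using i by (intro lex_pos_less) (auto simp: set_others)
  have eq: "?F' m = ?X m" if "m \<in> {1..d}" "m \<noteq> s" for m
    using that i lex_digits_lex_pos[of "others d s" i n m] by (auto simp: set_others distinct_others)
  have "prod_right (1\<^sub>m 1) ?F' [1..<s] = prod_upto (1\<^sub>m 1) ?F' (s - 1)"
    using s by (simp add: prod_upto_def)
  also have "\<dots> = prod_upto (1\<^sub>m 1) ?X (s - 1)"
    using s by (intro prod_upto_cong eq) auto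
  finally have 1: "prod_right (1\<^sub>m 1) ?F' [1..<s] = prod_upto (1\<^sub>m 1) ?X (s - 1)" .
  have "prod_left ?F' [s+1..<d+1] (1\<^sub>m 1) = prod_after ?F' s d (1\<^sub>m 1)"
    by (simp add: prod_after_def)
  also have "\<dots> = prod_after ?X s d (1\<^sub>m 1)"
    using s by (intro prod_after_cong eq) auto
  finally have 2: "prod_left ?F' [s+1..<d+1] (1\<^sub>m 1) = prod_after ?X s d (1\<^sub>m 1)" .
  have "train r d ?X" by (intro train_upd train_op_factor_mat g unit_mat_carrier)
  then have "tt_val d ?X = (prod_upto (1\<^sub>m 1) ?X (s - 1) * ?X s * prod_after ?X s d (1\<^sub>m 1)) $$ (0, 0)"
    using s by (rule tt_val_slot_mult)
  then show ?thesis
    unfolding E_mat_def using lt a by (simp add: Let_def 1[simplified] 2[simplified])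
qed

text \<open>Slot \<open>q\<close> splits into a first-order and a second-order part, and the other
  cores are scaled by their factor of the coefficient. The channel coefficient supplies the scalar
  missing in slot \<open>s\<close>, so full products over all coordinates appear.\<close>

lemma tt_val_op_factor_ne:
  assumes g: "core_train r d g" and s: "s \<in> {1..d}" and q: "q \<in> {1..d}" "q \<noteq> s"
    and M: "M \<in> carrier_mat (r (s - 1)) (r s)"
  shows "\<kappa> \<tau> s (z s) * tt_val d ((\<lambda>m. op_factor_mat \<kappa> \<tau> q m (g m) (z m))(s := M))
    = - (\<Prod>m=1..d. if m = q then deriv (\<kappa> \<tau> q) (z q) else \<kappa> \<tau> m (z m))
          * tt_val d ((coords g z)(s := M, q := mat_deriv (g q) (z q)))
      - (\<Prod>m=1..d. \<kappa> \<tau> m (z m)) * tt_val d ((coords g z)(s := M, q := mat_deriv (mat_deriv (g q)) (z q)))"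
proof -
  let ?F = "\<lambda>m. op_factor_mat \<kappa> \<tau> q m (g m) (z m)" and ?k = "\<lambda>m. \<kappa> \<tau> m (z m)"
  let ?W = "?F(s := ?k s \<cdot>\<^sub>m M)" and ?Y = "mat_deriv (g q) (z q)" and ?Z = "mat_deriv (mat_deriv (g q)) (z q)"
  have tF: "train r d ?F" by (rule train_op_factor_mat[OF g])
  have tx: "train r d ((coords g z)(s := M))" by (rule train_upd[OF train_coords[OF g] M])
  have Y: "?Y \<in> carrier_mat (r (q - 1)) (r q)" and Z: "?Z \<in> carrier_mat (r (q - 1)) (r q)"
    by (intro mat_deriv_carrier core_trainD[OF g q(1)])+
  have tW: "train r d ?W" using M by (intro train_upd[OF tF]) simp
  have "?k s * tt_val d (?F(s := M)) = tt_val d ?W"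
    by (rule tt_val_upd_scale[OF tF s M, symmetric])
  \<comment> \<open>Slot \<open>q\<close> is overwritten with its own content, so that linearity in
    that slot can be applied.\<close>
  also have "\<dots> = tt_val d (?W(q := ?F q))" using q by (simp add: fun_upd_idem)
  also have "\<dots> = (-1) * tt_val d (?W(q := deriv (\<kappa> \<tau> q) (z q) \<cdot>\<^sub>m ?Y)) + (-1) * tt_val d (?W(q := ?k q \<cdot>\<^sub>m ?Z))"
  proof (rule tt_val_upd_add[OF tW q(1)])
    show "?F q $$ (i, j) = -1 * (deriv (\<kappa> \<tau> q) (z q) \<cdot>\<^sub>m ?Y) $$ (i, j) + -1 * (?k q \<cdot>\<^sub>m ?Z) $$ (i, j)"
      if "i < r (q - 1)" "j < r q" for i j
      using that core_trainD[OF g q(1), of "z q"] Y Z mat_deriv_index[OF core_trainD[OF g q(1)] that]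
        mat_deriv2_index[OF core_trainD[OF g q(1)] that]
      by (simp add: op_factor_mat_def op_factor_def)
  qed (use Y Z trainD[OF tF q(1)] in auto)
  also have "tt_val d (?W(q := deriv (\<kappa> \<tau> q) (z q) \<cdot>\<^sub>m ?Y))
     = tt_val d (\<lambda>m. (if m = q then deriv (\<kappa> \<tau> q) (z q) else ?k m) \<cdot>\<^sub>m ((coords g z)(s := M, q := ?Y)) m)"
    using core_trainD[OF g]
    by (intro tt_val_cong) (auto simp: coords_def op_factor_mat_def op_factor_def intro!: eq_matI)
  also have "\<dots> = (\<Prod>m=1..d. if m = q then deriv (\<kappa> \<tau> q) (z q) else ?k m) * tt_val d ((coords g z)(s := M, q := ?Y))"
    by (rule tt_val_smult[OF train_upd[OF tx Y]])
  also have "tt_val d (?W(q := ?k q \<cdot>\<^sub>m ?Z)) = tt_val d (\<lambda>m. ?k m \<cdot>\<^sub>m ((coords g z)(s := M, q := ?Z)) m)"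
    using core_trainD[OF g]
    by (intro tt_val_cong) (auto simp: coords_def op_factor_mat_def op_factor_def intro!: eq_matI)
  also have "\<dots> = (\<Prod>m=1..d. ?k m) * tt_val d ((coords g z)(s := M, q := ?Z))"
    by (rule tt_val_smult[OF train_upd[OF tx Z]])
  finally show ?thesis unfolding mult_minus1 by (simp only: minus_mult_left diff_conv_add_uminus)
qed

text \<open>The scalar \<open>k\<close> stays free: it becomes the derivative of the factor for
  channel 1 and the factor itself for channel 2.\<close>

lemma tt_val_op_factor_eq:
  assumes g: "core_train r d g" and s: "s \<in> {1..d}" and M: "M \<in> carrier_mat (r (s - 1)) (r s)"
  shows "k * tt_val d ((\<lambda>m. op_factor_mat \<kappa> \<tau> s m (g m) (z m))(s := M))
    = (\<Prod>m=1..d. if m = s then k else \<kappa> \<tau> m (z m)) * tt_val d ((coords g z)(s := M))"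
proof -
  let ?F = "\<lambda>m. op_factor_mat \<kappa> \<tau> s m (g m) (z m)"
  have tF: "train r d ?F" by (rule train_op_factor_mat[OF g])
  have tx: "train r d ((coords g z)(s := M))" by (rule train_upd[OF train_coords[OF g] M])
  have "k * tt_val d (?F(s := M)) = tt_val d (?F(s := k \<cdot>\<^sub>m M))"
    by (rule tt_val_upd_scale[OF tF s M, symmetric])
  also have "\<dots> = tt_val d (\<lambda>m. (if m = s then k else \<kappa> \<tau> m (z m)) \<cdot>\<^sub>m ((coords g z)(s := M)) m)"
    using core_trainD[OF g]
    by (intro tt_val_cong) (auto simp: coords_def op_factor_mat_def op_factor_def intro!: eq_matI)
  also have "\<dots> = (\<Prod>m=1..d. if m = s then k else \<kappa> \<tau> m (z m)) * tt_val d ((coords g z)(s := M))"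
    by (rule tt_val_smult[OF tx])
  finally show ?thesis .
qed

lemma sum_E_mat_eq_channel_val:
  assumes dims: "1 \<le> dx" "1 \<le> dxi" and g: "core_train r (dx+dxi) g" and s: "s \<in> {1..dx+dxi}"
    and l: "l \<in> channels dx s" and M: "M \<in> carrier_mat (r (s - 1)) (r s)"
    and \<kappa>: "separable_factors dx dxi \<kappa>" and z: "in_box dx (dx+dxi) z"
  shows "(\<Sum>(\<tau>, q)\<in>qterms dxi \<times> {1..dx}. channel_coeff dx \<kappa> s l \<tau> q (z s)
      * tt_val (dx+dxi) ((\<lambda>m. op_factor_mat \<kappa> \<tau> q m (g m) (z m))(s := M)))
    = channel_val dx dxi g s l z M"
proof -
  define d where "d = dx + dxi"
  define T where "T \<tau> q = tt_val d ((\<lambda>m. op_factor_mat \<kappa> \<tau> q m (g m) (z m))(s := M))" for \<tau> q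
  define x where "x = (coords g z)(s := M)"
  define k where "k \<tau> = (\<Prod>m=1..d. \<kappa> \<tau> m (z m))" for \<tau>
  define k' where "k' \<tau> q = (\<Prod>m=1..d. if m = q then deriv (\<kappa> \<tau> q) (z q) else \<kappa> \<tau> m (z m))" for \<tau> q
  have sk: "(\<Sum>\<tau>\<in>qterms dxi. k \<tau>) = kappa_quad dx dxi z"
    unfolding k_def d_def by (rule sum_kappa[OF \<kappa> z])
  have sk': "(\<Sum>\<tau>\<in>qterms dxi. k' \<tau> q) = kappa_deriv dx dxi q z" if "q \<in> {1..dx}" for q
    unfolding k'_def d_def kappa_deriv_def by (rule sum_deriv_kappa[OF dims that \<kappa> z])
  \<comment> \<open>For fixed \<open>q\<close>, the term \<open>\<tau>\<close> enters only through
    scalar products; summing over it first gives the coefficient or its derivative.\<close>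
  have swap: "(\<Sum>(\<tau>, q)\<in>qterms dxi \<times> {1..dx}. channel_coeff dx \<kappa> s l \<tau> q (z s) * T \<tau> q)
      = (\<Sum>q=1..dx. \<Sum>\<tau>\<in>qterms dxi. channel_coeff dx \<kappa> s l \<tau> q (z s) * T \<tau> q)"
    by (subst sum.swap) (simp add: sum.cartesian_product)
  have s': "s \<in> {1..d}" using s by (simp add: d_def)
  have g': "core_train r d g" using g by (simp add: d_def)
  show ?thesis
  proof (cases "l = 0")
    case True
    have "(\<Sum>\<tau>\<in>qterms dxi. channel_coeff dx \<kappa> s l \<tau> q (z s) * T \<tau> q) = (if q = s then 0 else
         - kappa_deriv dx dxi q z * tt_val d (x(q := mat_deriv (g q) (z q)))
         - kappa_quad dx dxi z * tt_val d (x(q := mat_deriv (mat_deriv (g q)) (z q))))" if q: "q \<in> {1..dx}" for q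
    proof (cases "q = s")
      case False
      have q': "q \<in> {1..d}" using q by (simp add: d_def)
      have "channel_coeff dx \<kappa> s l \<tau> q (z s) * T \<tau> q = - k' \<tau> q * tt_val d (x(q := mat_deriv (g q) (z q)))
         - k \<tau> * tt_val d (x(q := mat_deriv (mat_deriv (g q)) (z q)))" for \<tau>
        using tt_val_op_factor_ne[OF g' s' q' False M, of \<kappa> \<tau> z] True False
        by (simp add: channel_coeff_def T_def k'_def k_def x_def)
      then show ?thesis using False sk sk'[OF q]
        by (simp add: sum_subtractf sum_negf sum_distrib_right[symmetric])
    qed (use True q in \<open>simp add: channel_coeff_def\<close>)
    then have "(\<Sum>q=1..dx. \<Sum>\<tau>\<in>qterms dxi. channel_coeff dx \<kappa> s l \<tau> q (z s) * T \<tau> q) = (\<Sum>q=1..dx. if q = s then 0 else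
         - kappa_deriv dx dxi q z * tt_val d (x(q := mat_deriv (g q) (z q)))
         - kappa_quad dx dxi z * tt_val d (x(q := mat_deriv (mat_deriv (g q)) (z q))))"
      by (rule sum.cong[OF refl])
    also have "\<dots> = (\<Sum>q\<in>{1..dx} - {s}.
         - kappa_deriv dx dxi q z * tt_val d (x(q := mat_deriv (g q) (z q)))
         - kappa_quad dx dxi z * tt_val d (x(q := mat_deriv (mat_deriv (g q)) (z q))))"
      by (rule sum.mono_neutral_cong_right) auto
    finally show ?thesis
      using swap True by (simp add: T_def d_def channel_val_def x_def)
  next
    case False
    then have sx: "s \<in> {1..dx}" and l12: "l = 1 \<or> l = 2" using l s by (auto simp: channels_def split: if_splits)
    have "(\<Sum>\<tau>\<in>qterms dxi. channel_coeff dx \<kappa> s l \<tau> q (z s) * T \<tau> q)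
       = (if q = s then - (if l = 1 then kappa_deriv dx dxi s z else kappa_quad dx dxi z) * tt_val d x else 0)" for q
    proof (cases "q = s")
      case True
      have "channel_coeff dx \<kappa> s l \<tau> s (z s) * T \<tau> s = - (if l = 1 then k' \<tau> s else k \<tau>) * tt_val d x" for \<tau>
      proof -
        have "(\<Prod>m=1..d. if m = s then \<kappa> \<tau> s (z s) else \<kappa> \<tau> m (z m)) = k \<tau>"
          unfolding k_def by (intro prod.cong) auto
        then show ?thesis
          using tt_val_op_factor_eq[OF g' s' M, of "deriv (\<kappa> \<tau> s) (z s)" \<kappa> \<tau> z]
            tt_val_op_factor_eq[OF g' s' M, of "\<kappa> \<tau> s (z s)" \<kappa> \<tau> z] l12 sx
          by (auto simp: channel_coeff_def T_def k'_def x_def)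
      qed
      then show ?thesis using True sk sk'[OF sx]
        by (auto simp: sum_negf sum_distrib_right[symmetric])
    qed (use False sx in \<open>auto simp: channel_coeff_def intro!: sum.neutral\<close>)
    then show ?thesis
      using swap sx False by (simp add: T_def d_def channel_val_def x_def)
  qed
qed

text \<open>Each channel is linear in the core in slot \<open>s\<close>. This passes from unit
  matrices, which index the columns of a direction matrix, to the core whose entries the channel
  matrix lists.\<close>

lemma channel_val_expansion:
  assumes g: "core_train r (dx+dxi) g" and s: "s \<in> {1..dx+dxi}" and Y: "Y \<in> carrier_mat (r (s - 1)) (r s)"
  shows "(\<Sum>a<rank_prod r s. channel_val dx dxi g s l z (unit_mat r s a) * Y $$ (a div r s, a mod r s))
    = channel_val dx dxi g s l z Y"
proof -
  let ?d = "dx + dxi" and ?R = "{..<rank_prod r s}"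
  have e0: "(\<Sum>a\<in>?R. tt_val ?d ((coords g z)(s := unit_mat r s a)) * Y $$ (a div r s, a mod r s))
      = tt_val ?d ((coords g z)(s := Y))"
    by (rule tt_val_unit_expansion[OF train_coords[OF g] s Y])
  \<comment> \<open>Because \<open>q\<close> differs from \<open>s\<close>, the two updates commute
    and the expansion applies to the train already modified in slot \<open>q\<close>.\<close>
  have e1: "(\<Sum>a\<in>?R. tt_val ?d ((coords g z)(s := unit_mat r s a, q := V)) * Y $$ (a div r s, a mod r s))
      = tt_val ?d ((coords g z)(s := Y, q := V))"
    if "q \<in> {1..?d}" "q \<noteq> s" "V \<in> carrier_mat (r (q - 1)) (r q)" for q V
    using tt_val_unit_expansion[OF train_upd[OF train_coords[OF g] that(3)] s Y, of z] that(2)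
    by (simp add: fun_upd_twist)
  show ?thesis
  proof (cases "l = 0")
    case True
    have "(\<Sum>a\<in>?R. channel_val dx dxi g s l z (unit_mat r s a) * Y $$ (a div r s, a mod r s))
      = (\<Sum>q\<in>{1..dx} - {s}. \<Sum>a\<in>?R.
          - kappa_deriv dx dxi q z * (tt_val ?d ((coords g z)(s := unit_mat r s a, q := mat_deriv (g q) (z q))) * Y $$ (a div r s, a mod r s))
          - kappa_quad dx dxi z * (tt_val ?d ((coords g z)(s := unit_mat r s a, q := mat_deriv (mat_deriv (g q)) (z q))) * Y $$ (a div r s, a mod r s)))"
      using True by (subst sum.swap) (simp add: channel_val_def sum_distrib_right left_diff_distrib mult.assoc)
    also have "\<dots> = (\<Sum>q\<in>{1..dx} - {s}.
          - kappa_deriv dx dxi q z * tt_val ?d ((coords g z)(s := Y, q := mat_deriv (g q) (z q)))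
          - kappa_quad dx dxi z * tt_val ?d ((coords g z)(s := Y, q := mat_deriv (mat_deriv (g q)) (z q))))"
    proof (intro sum.cong refl)
      fix q assume "q \<in> {1..dx} - {s}"
      then have q: "q \<in> {1..?d}" "q \<noteq> s" by auto
      show "(\<Sum>a\<in>?R.
          - kappa_deriv dx dxi q z * (tt_val ?d ((coords g z)(s := unit_mat r s a, q := mat_deriv (g q) (z q))) * Y $$ (a div r s, a mod r s))
          - kappa_quad dx dxi z * (tt_val ?d ((coords g z)(s := unit_mat r s a, q := mat_deriv (mat_deriv (g q)) (z q))) * Y $$ (a div r s, a mod r s)))
        = - kappa_deriv dx dxi q z * tt_val ?d ((coords g z)(s := Y, q := mat_deriv (g q) (z q)))
          - kappa_quad dx dxi z * tt_val ?d ((coords g z)(s := Y, q := mat_deriv (mat_deriv (g q)) (z q)))"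
        unfolding sum_subtractf sum_distrib_left[symmetric]
        using core_trainD[OF g q(1)] by (subst (1 2) e1[OF q]) (auto intro!: mat_deriv_carrier)
    qed
    finally show ?thesis using True by (simp add: channel_val_def)
  next
    case False
    have "(\<Sum>a\<in>?R. c * tt_val ?d ((coords g z)(s := unit_mat r s a)) * Y $$ (a div r s, a mod r s))
       = c * tt_val ?d ((coords g z)(s := Y))" for c
      unfolding e0[symmetric] sum_distrib_left by (simp add: mult.assoc)
    from this[of "- kappa_deriv dx dxi s z"] this[of "- kappa_quad dx dxi z"]
    show ?thesis using False by (auto simp: channel_val_def)
  qed
qed

section \<open>Differentiating cores\<close>

lemma deriv_within_eqI:
  assumes "(f has_vector_derivative y) (at x within {a..b})" "x \<in> {a..b}" "a < b"
  shows "deriv_within {a..b} f x = y"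
  unfolding deriv_within_def using assms by (intro vector_derivative_within_closed_interval) auto

lemma deriv_within_works:
  "f differentiable (at x within S) \<Longrightarrow> (f has_vector_derivative deriv_within S f x) (at x within S)"
  unfolding deriv_within_def by (simp add: vector_derivative_works)

text \<open>Induction on the order: on a nondegenerate interval the derivative within
  \<open>S\<close> is unique, which identifies the next iterate. Only the values of \<open>h\<close>
  on \<open>S\<close> are prescribed, so the lemma also transfers derivatives between functions that
  agree there.\<close>

lemma deriv_within_pow_linear:
  assumes S: "S = {a..b}" "a < b" and f: "Ck_on k S f" and g: "Ck_on k S g"
    and h: "\<And>x. x \<in> S \<Longrightarrow> h x = u * f x + v * g x"
    and "l \<le> k" "x \<in> S"
  shows "(deriv_within S ^^ l) h x = u * (deriv_within S ^^ l) f x + v * (deriv_within S ^^ l) g x"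
  using assms(6,7)
proof (induction l arbitrary: x)
  case (Suc l)
  let ?f = "(deriv_within S ^^ l) f" and ?g = "(deriv_within S ^^ l) g"
  have "?f differentiable_on S" "?g differentiable_on S"
    using f g Suc.prems by (auto simp: Ck_on_def)
  then have "(?f has_vector_derivative deriv_within S ?f x) (at x within S)"
    "(?g has_vector_derivative deriv_within S ?g x) (at x within S)"
    using Suc.prems by (auto simp: differentiable_on_def intro!: deriv_within_works)
  then have "((\<lambda>y. u * ?f y + v * ?g y) has_vector_derivative
      u * deriv_within S ?f x + v * deriv_within S ?g x) (at x within S)"
    by (intro has_vector_derivative_add has_vector_derivative_mult_right)
  then have "((deriv_within S ^^ l) h has_vector_derivative
      u * deriv_within S ?f x + v * deriv_within S ?g x) (at x within S)"
    using Suc by (elim has_vector_derivative_transform[rotated 2]) auto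
  then show ?case using Suc.prems S by (simp add: deriv_within_eqI)
qed (use h in simp)

lemma Ck_on_linear:
  assumes S: "S = {a..b}" "a < b" and f: "Ck_on k S f" and g: "Ck_on k S g"
    and h: "\<And>x. x \<in> S \<Longrightarrow> h x = u * f x + v * g x"
  shows "Ck_on k S h"
proof -
  note eq = deriv_within_pow_linear[OF assms]
  have "(deriv_within S ^^ l) h differentiable_on S" if "l < k" for l
  proof -
    have "(\<lambda>x. u * (deriv_within S ^^ l) f x + v * (deriv_within S ^^ l) g x) differentiable_on S"
      using f g that by (auto simp: Ck_on_def intro!: derivative_intros)
    then show ?thesis using that eq[of l]
      unfolding differentiable_on_def by (auto intro: differentiable_transform_within[of _ _ _ 1])
  qed
  moreover have "continuous_on S (\<lambda>x. u * (deriv_within S ^^ k) f x + v * (deriv_within S ^^ k) g x)"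
    using f g by (auto simp: Ck_on_def intro!: continuous_intros)
  then have "continuous_on S ((deriv_within S ^^ k) h)"
    using eq[of k] by (simp cong: continuous_on_cong)
  ultimately show ?thesis by (simp add: Ck_on_def)
qed

lemma Ck_on_cong:
  assumes "S = {a..b}" "a < b" "Ck_on k S f" "\<And>x. x \<in> S \<Longrightarrow> h x = f x"
  shows "Ck_on k S h"
  by (rule Ck_on_linear[OF assms(1,2,3,3), of h 1 0]) (simp add: assms(4))

lemma abs_le_Ck_norm:
  assumes "compact S" "Ck_on k S f" "x \<in> S"
  shows "\<bar>f x\<bar> \<le> Ck_norm k S f"
proof -
  have bdd: "bdd_above ((\<lambda>x. \<bar>(deriv_within S ^^ l) f x\<bar>) ` S)" if "l \<le> k" for l
  proof -
    have "continuous_on S ((deriv_within S ^^ l) f)"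
      using assms(2) that by (cases "l = k") (auto simp: Ck_on_def intro!: differentiable_imp_continuous_on)
    then have "compact ((\<lambda>x. \<bar>(deriv_within S ^^ l) f x\<bar>) ` S)"
      using assms(1) by (intro compact_continuous_image continuous_intros)
    then show ?thesis by (intro bounded_imp_bdd_above compact_imp_bounded)
  qed
  have le: "\<bar>(deriv_within S ^^ l) f x\<bar> \<le> (SUP x\<in>S. \<bar>(deriv_within S ^^ l) f x\<bar>)" if "l \<le> k" for l
    using bdd[OF that] assms(3) by (rule cSUP_upper[rotated])
  \<comment> \<open>Every summand of the norm is nonnegative, so the supremum of order zero is
    bounded by their sum.\<close>
  have "0 \<le> (SUP x\<in>S. \<bar>(deriv_within S ^^ l) f x\<bar>)" if "l \<le> k" for l
    by (rule order_trans[OF abs_ge_zero le[OF that]])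
  then have "(SUP x\<in>S. \<bar>(deriv_within S ^^ 0) f x\<bar>) \<le> Ck_norm k S f"
    unfolding Ck_norm_def by (intro member_le_sum[where i = 0]) simp_all
  then show ?thesis using le[of 0] by simp
qed

text \<open>Evaluation at a point is dominated by the C^k norm, so Frechet differentiability implies
  pointwise derivatives in the parameter, with a limit function that is again of class C^k.\<close>

lemma Ck_differentiable_at_has_derivative:
  assumes S: "S = {a..b}" "a < b" and F: "Ck_differentiable_at k S P F \<theta>" and \<theta>: "\<theta> \<in> carrier_vec P"
    and Ck: "\<And>\<theta>'. \<theta>' \<in> carrier_vec P \<Longrightarrow> Ck_on k S (F \<theta>')" and p: "p < P"
  obtains D where "Ck_on k S D"
    "\<And>x. x \<in> S \<Longrightarrow> ((\<lambda>t. F (\<theta> + t \<cdot>\<^sub>v unit_vec P p) x) has_real_derivative D x) (at 0)"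
proof -
  obtain D where D: "\<forall>p<P. Ck_on k S (D p)" and
    lim: "\<forall>e>0. \<exists>\<delta>>0. \<forall>h\<in>carrier_vec P. sqrt (scalar_prod h h) < \<delta> \<longrightarrow>
        Ck_norm k S (\<lambda>t. F (\<theta> + h) t - F \<theta> t - (\<Sum>p<P. vec_index h p * D p t)) \<le> e * sqrt (scalar_prod h h)"
    using F unfolding Ck_differentiable_at_def by (elim exE conjE)
  have deriv: "((\<lambda>t. F (\<theta> + t \<cdot>\<^sub>v unit_vec P p) x) has_real_derivative D p x) (at 0)" if x: "x \<in> S" for x
    unfolding has_field_derivative_def has_derivative_at_alt
  proof (intro conjI allI impI)
    show "bounded_linear ((*) (D p x))" by (rule bounded_linear_mult_right)
    fix e :: real assume "0 < e"
    from lim[rule_format, OF this] obtain \<delta> where "\<delta> > 0" and \<delta>: "\<forall>h\<in>carrier_vec P. sqrt (scalar_prod h h) < \<delta> \<longrightarrow>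
        Ck_norm k S (\<lambda>t. F (\<theta> + h) t - F \<theta> t - (\<Sum>p<P. vec_index h p * D p t)) \<le> e * sqrt (scalar_prod h h)"
      by (elim exE conjE)
    have "\<bar>F (\<theta> + t \<cdot>\<^sub>v unit_vec P p) x - F (\<theta> + 0 \<cdot>\<^sub>v unit_vec P p) x - D p x * (t - 0)\<bar> \<le> e * \<bar>t - 0\<bar>"
      if t: "\<bar>t - 0\<bar> < \<delta>" for t
    proof -
      define h where "h = t \<cdot>\<^sub>v unit_vec P p"
      have h: "h \<in> carrier_vec P" by (simp add: h_def)
      have hh: "sqrt (scalar_prod h h) = \<bar>t\<bar>"
        using p by (simp add: h_def)
      have sum: "(\<Sum>p<P. vec_index h p * D p y) = t * D p y" for y
      proof -
        have "(\<Sum>q<P. vec_index h q * D q y) = (\<Sum>q<P. if q = p then t * D p y else 0)"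
          by (intro sum.cong) (auto simp: h_def unit_vec_def)
        then show ?thesis using p by simp
      qed
      \<comment> \<open>The remainder must be of class C^k itself: otherwise the suprema in its norm
        need not bound its values.\<close>
      have "Ck_on k S (\<lambda>y. F (\<theta> + h) y - F \<theta> y)"
        by (rule Ck_on_linear[OF S Ck Ck, of "\<theta> + h" \<theta> _ 1 "-1"]) (use h \<theta> in auto)
      then have "Ck_on k S (\<lambda>y. F (\<theta> + h) y - F \<theta> y - t * D p y)"
        by (rule Ck_on_linear[OF S _ D[rule_format, OF p], of _ _ 1 "-t"]) simp
      then have "\<bar>F (\<theta> + h) x - F \<theta> x - t * D p x\<bar> \<le> Ck_norm k S (\<lambda>y. F (\<theta> + h) y - F \<theta> y - t * D p y)"
        using x S by (intro abs_le_Ck_norm) auto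
      also have "\<dots> \<le> e * \<bar>t\<bar>" using \<delta>[rule_format, OF h] t by (simp add: hh sum)
      moreover have "\<theta> + 0 \<cdot>\<^sub>v unit_vec P p = \<theta>" using \<theta> by (intro eq_vecI) auto
      ultimately show ?thesis by (simp add: h_def mult.commute)
    qed
    then show "\<exists>d>0. \<forall>y. norm (y - 0) < d \<longrightarrow> norm (F (\<theta> + y \<cdot>\<^sub>v unit_vec P p) x - F (\<theta> + 0 \<cdot>\<^sub>v unit_vec P p) x
        - D p x * (y - 0)) \<le> e * norm (y - 0)"
      using \<open>\<delta> > 0\<close> by (intro exI[of _ \<delta>]) simp
  qed
  show thesis by (rule that[of "D p"]) (use D p deriv in auto)
qed

section \<open>Interior derivatives and regularity of the parameter derivative\<close>

lemma closure_Dom: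
  obtains a b where "closure (Dom dx m) = {a..b}" "a < b"
proof -
  have "closure (Dom dx m) = {(if m \<le> dx then 0 else -1)..1}" by (simp add: Dom_def)
  then show thesis by (rule that) simp
qed

text \<open>At interior points the derivative within the closed interval is the two-sided one. This
  links the C^2 assumption on the closure to the \<open>deriv\<close> used by the operator and by
  \<open>mat_deriv\<close>.\<close>

lemma Ck_on_2_interior:
  assumes f: "Ck_on 2 (closure (Dom dx m)) f" and t: "t \<in> Dom dx m"
  shows "(f has_real_derivative deriv f t) (at t)" "(deriv f has_real_derivative deriv (deriv f) t) (at t)"
proof -
  let ?S = "closure (Dom dx m)"
  obtain a b where S: "?S = {a..b}" "a < b" by (rule closure_Dom)
  have sub: "Dom dx m \<subseteq> ?S" by (rule closure_subset)
  have der: "(h has_real_derivative deriv h x) (at x)" if "h differentiable_on ?S" "x \<in> Dom dx m" for h :: "real \<Rightarrow> real" and x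
  proof -
    have "h differentiable_on Dom dx m" using that(1) sub by (rule differentiable_on_subset)
    then have "h differentiable at x" using that(2) by (simp add: differentiable_on_eq_differentiable_at open_Dom)
    then show ?thesis by (simp add: DERIV_deriv_iff_real_differentiable)
  qed
  have diff: "(deriv_within ?S ^^ l) f differentiable_on ?S" if "l < 2" for l
    using f that by (simp add: Ck_on_def)
  have d0: "f differentiable_on ?S" using diff[of 0] by simp
  have d1: "deriv_within ?S f differentiable_on ?S" using diff[of 1] by simp
  have eq: "deriv_within ?S f x = deriv f x" if x: "x \<in> Dom dx m" for x
  proof -
    have "(f has_vector_derivative deriv f x) (at x within ?S)"
      using der[OF d0 x] by (auto simp: has_real_derivative_iff_has_vector_derivative intro: has_vector_derivative_at_within)
    then show ?thesis using sub x S by (simp add: deriv_within_eqI subset_iff)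
  qed
  show "(f has_real_derivative deriv f t) (at t)" by (rule der[OF d0 t])
  \<comment> \<open>The two first derivatives agree on an open set, so they have the same derivative
    at \<open>t\<close>.\<close>
  have "(deriv f has_real_derivative deriv (deriv_within ?S f) t) (at t)"
    using der[OF d1 t] eq by (rule has_field_derivative_transform_within_open[OF _ open_Dom t])
  then show "(deriv f has_real_derivative deriv (deriv f) t) (at t)"
    by (simp add: DERIV_imp_deriv)
qed

text \<open>\<open>param_deriv_G\<close> is a pointwise \<open>deriv\<close>; on the closed interval
  it coincides with the C^k-valued derivative and inherits its regularity.\<close>

lemma param_deriv_G_Ck:
  assumes ansatz: "tt_ansatz dx dxi r P H rep G" and s: "s \<in> {1..dx+dxi}" and \<theta>: "\<theta> s \<in> carrier_vec (P s)"
    and p: "p < P s" and ij: "i < r (s - 1)" "j < r s"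
  shows "Ck_on (max_order dx s) (closure (Dom dx s)) (param_deriv_G P G \<theta> s p (i, j))"
    and "x \<in> closure (Dom dx s) \<Longrightarrow> ((\<lambda>t. G s (\<theta> s + t \<cdot>\<^sub>v unit_vec (P s) p) x $$ (i, j)) has_real_derivative
      param_deriv_G P G \<theta> s p (i, j) x) (at 0)"
proof -
  obtain a b where S: "closure (Dom dx s) = {a..b}" "a < b" by (rule closure_Dom)
  have cd: "Ck_differentiable_at (max_order dx s) (closure (Dom dx s)) (P s) (\<lambda>\<theta>' t. G s \<theta>' t $$ (i, j)) (\<theta> s)"
    and ck: "\<And>\<theta>'. \<theta>' \<in> carrier_vec (P s) \<Longrightarrow> Ck_on (max_order dx s) (closure (Dom dx s)) (\<lambda>t. G s \<theta>' t $$ (i, j))"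
    using ansatz s \<theta> ij by (auto simp: tt_ansatz_def)
  obtain D where D: "Ck_on (max_order dx s) (closure (Dom dx s)) D" and
    d: "\<And>x. x \<in> closure (Dom dx s) \<Longrightarrow> ((\<lambda>t. G s (\<theta> s + t \<cdot>\<^sub>v unit_vec (P s) p) x $$ (i, j)) has_real_derivative D x) (at 0)"
    using Ck_differentiable_at_has_derivative[OF S cd \<theta> ck p] by metis
  have eq: "param_deriv_G P G \<theta> s p (i, j) x = D x" if "x \<in> closure (Dom dx s)" for x
    unfolding param_deriv_G_def by (rule DERIV_imp_deriv[OF d[OF that]])
  show "Ck_on (max_order dx s) (closure (Dom dx s)) (param_deriv_G P G \<theta> s p (i, j))"
    by (rule Ck_on_cong[OF S D eq])
  show "((\<lambda>t. G s (\<theta> s + t \<cdot>\<^sub>v unit_vec (P s) p) x $$ (i, j)) has_real_derivative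
      param_deriv_G P G \<theta> s p (i, j) x) (at 0)" if "x \<in> closure (Dom dx s)"
    using d[OF that] eq[OF that] by simp
qed

section \<open>The Darcy operator on tensor trains\<close>

text \<open>Only spatial cores are constrained, since the operator differentiates in no other
  coordinate.\<close>

definition smooth_cores :: "(nat \<Rightarrow> nat) \<Rightarrow> nat \<Rightarrow> (nat \<Rightarrow> real \<Rightarrow> real mat) \<Rightarrow> bool" where
  "smooth_cores r dx h \<longleftrightarrow> (\<forall>m\<in>{1..dx}. \<forall>i<r (m - 1). \<forall>j<r m. \<forall>t\<in>Dom dx m.
     ((\<lambda>t. h m t $$ (i, j)) has_real_derivative deriv (\<lambda>t. h m t $$ (i, j)) t) (at t) \<and>
     (deriv (\<lambda>t. h m t $$ (i, j)) has_real_derivative deriv (deriv (\<lambda>t. h m t $$ (i, j))) t) (at t))"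

text \<open>The product rule in each spatial coordinate, where just the coefficient and core
  \<open>q\<close> vary. Agreement of \<open>v\<close> with the train inside the box suffices
  because the coordinate domains are open.\<close>

lemma darcy_tt_val:
  assumes dims: "1 \<le> dx" "1 \<le> dxi" and h: "core_train r (dx+dxi) h" and sm: "smooth_cores r dx h"
    and v: "\<And>y. in_box dx (dx+dxi) y \<Longrightarrow> v y = tt_val (dx+dxi) (coords h y)"
    and z: "in_box dx (dx+dxi) z"
  shows "darcy dx dxi v z = (\<Sum>q=1..dx.
      - kappa_deriv dx dxi q z * tt_val (dx+dxi) ((coords h z)(q := mat_deriv (h q) (z q)))
      - kappa_quad dx dxi z * tt_val (dx+dxi) ((coords h z)(q := mat_deriv (mat_deriv (h q)) (z q))))"
proof -
  let ?d = "dx + dxi"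
  have "pderiv_coord q (\<lambda>y. kappa_quad dx dxi y * pderiv_coord q v y) z =
      kappa_deriv dx dxi q z * tt_val ?d ((coords h z)(q := mat_deriv (h q) (z q)))
      + kappa_quad dx dxi z * tt_val ?d ((coords h z)(q := mat_deriv (mat_deriv (h q)) (z q)))"
    if q: "q \<in> {1..dx}" for q
  proof -
    have q': "q \<in> {1..?d}" using q by simp
    have zq: "z q \<in> Dom dx q" using z q' by (simp add: in_box_def)
    have car: "h q t \<in> carrier_mat (r (q - 1)) (r q)" for t by (rule core_trainD[OF h q'])
    have car': "mat_deriv (h q) t \<in> carrier_mat (r (q - 1)) (r q)" for t by (rule mat_deriv_carrier[OF car])
    have car'': "mat_deriv (mat_deriv (h q)) t \<in> carrier_mat (r (q - 1)) (r q)" for t by (rule mat_deriv_carrier[OF car'])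
    note tr = train_upd[OF train_coords[OF h]]
    have D1: "((\<lambda>t. tt_val ?d ((coords h y)(q := h q t))) has_real_derivative
        tt_val ?d ((coords h y)(q := mat_deriv (h q) t))) (at t)" if t: "t \<in> Dom dx q" for y t
      using sm q t
      by (intro has_real_derivative_tt_val[OF tr[OF car] q' tr[OF car']])
        (auto simp: mat_deriv_index[OF car] smooth_cores_def)
    have D2: "((\<lambda>t. tt_val ?d ((coords h y)(q := mat_deriv (h q) t))) has_real_derivative
        tt_val ?d ((coords h y)(q := mat_deriv (mat_deriv (h q)) t))) (at t)" if t: "t \<in> Dom dx q" for y t
    proof (rule has_real_derivative_tt_val[OF tr[OF car'] q' tr[OF car'']])
      fix i j assume ij: "i < r (q - 1)" "j < r q"
      have "(\<lambda>u. mat_deriv (h q) u $$ (i, j)) = deriv (\<lambda>t. h q t $$ (i, j))"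
        using mat_deriv_index[OF car ij] by (intro ext)
      then show "((\<lambda>u. mat_deriv (h q) u $$ (i, j)) has_real_derivative mat_deriv (mat_deriv (h q)) t $$ (i, j)) (at t)"
        using sm q t ij by (simp add: smooth_cores_def mat_deriv2_index[OF car ij] numeral_2_eq_2)
    qed
    \<comment> \<open>The first derivative is needed throughout the box, not only at
      \<open>z\<close>, because it is differentiated once more.\<close>
    have p1: "pderiv_coord q v y = tt_val ?d ((coords h y)(q := mat_deriv (h q) (y q)))" if y: "in_box dx ?d y" for y
      unfolding pderiv_coord_def
    proof (rule DERIV_imp_deriv)
      have yq: "y q \<in> Dom dx q" using y q' by (simp add: in_box_def)
      show "((\<lambda>t. v (y(q := t))) has_real_derivative tt_val ?d ((coords h y)(q := mat_deriv (h q) (y q)))) (at (y q))"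
        by (rule has_field_derivative_transform_within_open[OF D1[OF yq] open_Dom yq])
          (simp add: v in_box_upd y coords_upd)
    qed
    have "((\<lambda>t. kappa_quad dx dxi (z(q := t)) * tt_val ?d ((coords h z)(q := mat_deriv (h q) t))) has_real_derivative
        kappa_deriv dx dxi q z * tt_val ?d ((coords h z)(q := mat_deriv (h q) (z q)))
        + tt_val ?d ((coords h z)(q := mat_deriv (mat_deriv (h q)) (z q))) * kappa_quad dx dxi (z(q := z q))) (at (z q))"
      unfolding kappa_deriv_def by (intro DERIV_mult kappa_quad_has_derivative dims q D2 zq)
    then have "((\<lambda>t. kappa_quad dx dxi (z(q := t)) * pderiv_coord q v (z(q := t))) has_real_derivative
        kappa_deriv dx dxi q z * tt_val ?d ((coords h z)(q := mat_deriv (h q) (z q)))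
        + tt_val ?d ((coords h z)(q := mat_deriv (mat_deriv (h q)) (z q))) * kappa_quad dx dxi (z(q := z q))) (at (z q))"
      by (rule has_field_derivative_transform_within_open[OF _ open_Dom zq])
        (simp add: p1 in_box_upd z coords_upd)
    from DERIV_imp_deriv[OF this] show ?thesis by (simp add: pderiv_coord_def mult.commute)
  qed
  then show ?thesis by (simp add: darcy_def sum_negf[symmetric])
qed

section \<open>The parameter derivative as a tensor train\<close>

definition param_core ::
  "(nat \<Rightarrow> nat) \<Rightarrow> (nat \<Rightarrow> nat) \<Rightarrow> (nat \<Rightarrow> real vec \<Rightarrow> real \<Rightarrow> real mat) \<Rightarrow> (nat \<Rightarrow> real vec) \<Rightarrow>
   nat \<Rightarrow> nat \<Rightarrow> nat \<Rightarrow> real \<Rightarrow> real mat" where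
  "param_core r P G \<theta> s p l x = mat (r (s - 1)) (r s) (\<lambda>ij. (deriv ^^ l) (param_deriv_G P G \<theta> s p ij) x)"

lemma param_core_carrier: "param_core r P G \<theta> s p l x \<in> carrier_mat (r (s - 1)) (r s)"
  by (simp add: param_core_def)

lemma param_core_index:
  "i < r (s - 1) \<Longrightarrow> j < r s \<Longrightarrow> param_core r P G \<theta> s p l x $$ (i, j) = (deriv ^^ l) (param_deriv_G P G \<theta> s p (i, j)) x"
  by (simp add: param_core_def)

lemma mat_deriv_param_core: "mat_deriv (param_core r P G \<theta> s p l) = param_core r P G \<theta> s p (Suc l)"
proof (intro ext eq_matI)
  fix x i j assume "i < dim_row (param_core r P G \<theta> s p (Suc l) x)" "j < dim_col (param_core r P G \<theta> s p (Suc l) x)"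
  then have ij: "i < r (s - 1)" "j < r s" by (simp_all add: param_core_def)
  show "mat_deriv (param_core r P G \<theta> s p l) x $$ (i, j) = param_core r P G \<theta> s p (Suc l) x $$ (i, j)"
    by (simp add: mat_deriv_index[OF param_core_carrier ij] param_core_index ij del: One_nat_def)
qed (simp_all add: param_core_def)

text \<open>Only core \<open>s\<close> depends on this parameter, so the derivative is the train
  with the differentiated core in slot \<open>s\<close>. In the sum over \<open>q\<close>, the two
  halves of the term \<open>q = s\<close> are channels 1 and 2; all other terms form channel
  0.\<close>

lemma darcy_param_deriv_u:
  assumes dims: "1 \<le> dx" "1 \<le> dxi" and ansatz: "tt_ansatz dx dxi r P H rep G"
    and \<theta>: "\<forall>m\<in>{1..dx+dxi}. \<theta> m \<in> carrier_vec (P m)" and s: "s \<in> {1..dx+dxi}" and p: "p < P s"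
    and z: "in_box dx (dx+dxi) z"
  defines "g \<equiv> \<lambda>m. G m (\<theta> m)"
  shows "darcy dx dxi (param_deriv_u (dx+dxi) P G \<theta> s p) z =
    (\<Sum>l\<in>channels dx s. channel_val dx dxi g s l z (param_core r P G \<theta> s p l (z s)))"
proof -
  let ?d = "dx + dxi" and ?Y = "\<lambda>l. param_core r P G \<theta> s p l"
  define h where "h = g(s := ?Y 0)"
  have g: "core_train r ?d g" using ansatz \<theta> by (auto simp: core_train_def tt_ansatz_def g_def)
  have h: "core_train r ?d h" using g param_core_carrier by (auto simp: core_train_def h_def)
  have hs: "h s = ?Y 0" and hq: "\<And>q. q \<noteq> s \<Longrightarrow> h q = g q" by (auto simp: h_def)
  have ch: "coords h y = (coords g y)(s := ?Y 0 (y s))" for y by (auto simp: coords_def h_def)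
  have "smooth_cores r dx h"
    unfolding smooth_cores_def
  proof (intro ballI allI impI)
    fix m i j t assume m: "m \<in> {1..dx}" and ij: "i < r (m - 1)" "j < r m" and t: "t \<in> Dom dx m"
    have m': "m \<in> {1..?d}" and ord: "max_order dx m = 2" using m by (auto simp: max_order_def)
    have "Ck_on 2 (closure (Dom dx m)) (\<lambda>t. h m t $$ (i, j))"
    proof (cases "m = s")
      case True
      have "(\<lambda>t. h m t $$ (i, j)) = param_deriv_G P G \<theta> s p (i, j)"
        using True ij by (auto simp: h_def param_core_index)
      then show ?thesis
        using param_deriv_G_Ck(1)[where \<theta> = \<theta>, OF ansatz s _ p] \<theta> s True ij ord by simp
    next
      case False
      have "Ck_on (max_order dx m) (closure (Dom dx m)) (\<lambda>t. G m (\<theta> m) t $$ (i, j))"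
        using ansatz m' ij \<theta> unfolding tt_ansatz_def by blast
      then show ?thesis using False ord by (simp add: h_def g_def)
    qed
    from Ck_on_2_interior[OF this t]
    show "((\<lambda>t. h m t $$ (i, j)) has_real_derivative deriv (\<lambda>t. h m t $$ (i, j)) t) (at t) \<and>
      (deriv (\<lambda>t. h m t $$ (i, j)) has_real_derivative deriv (deriv (\<lambda>t. h m t $$ (i, j))) t) (at t)" by blast
  qed
  moreover have "param_deriv_u ?d P G \<theta> s p y = tt_val ?d (coords h y)" if y: "in_box dx ?d y" for y
  proof -
    let ?F = "\<lambda>t. G s (\<theta> s + t \<cdot>\<^sub>v unit_vec (P s) p) (y s)"
    have ys: "y s \<in> closure (Dom dx s)" using y s closure_subset by (fastforce simp: in_box_def)
    have eq: "tt_fun ?d G (\<theta>(s := \<theta> s + t \<cdot>\<^sub>v unit_vec (P s) p)) y = tt_val ?d ((coords g y)(s := ?F t))" for t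
      unfolding tt_val_def prod_upto_def tt_fun_def
      by (rule arg_cong[where f = "\<lambda>F. prod_right _ F _ $$ _"]) (auto simp: coords_def g_def)
    have car: "?F t \<in> carrier_mat (r (s - 1)) (r s)" for t
      using ansatz s \<theta> by (auto simp: tt_ansatz_def)
    have "((\<lambda>t. tt_val ?d ((coords g y)(s := ?F t))) has_real_derivative tt_val ?d ((coords g y)(s := ?Y 0 (y s)))) (at 0)"
    proof (rule has_real_derivative_tt_val[OF train_upd[OF train_coords[OF g] car] s])
      show "train r ?d ((coords g y)(s := ?Y 0 (y s)))"
        by (intro train_upd train_coords g param_core_carrier)
      show "((\<lambda>t. ?F t $$ (i, j)) has_real_derivative ?Y 0 (y s) $$ (i, j)) (at 0)" if "i < r (s - 1)" "j < r s" for i j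
        using param_deriv_G_Ck(2)[where \<theta> = \<theta>, OF ansatz s _ p that ys] \<theta> s by (simp add: param_core_index[OF that])
    qed
    then show ?thesis
      unfolding param_deriv_u_def eq ch by (rule DERIV_imp_deriv)
  qed
  ultimately have darcy: "darcy dx dxi (param_deriv_u ?d P G \<theta> s p) z = (\<Sum>q=1..dx.
      - kappa_deriv dx dxi q z * tt_val ?d ((coords h z)(q := mat_deriv (h q) (z q)))
      - kappa_quad dx dxi z * tt_val ?d ((coords h z)(q := mat_deriv (mat_deriv (h q)) (z q))))"
    by (intro darcy_tt_val[OF dims h _ _ z])
  let ?t = "\<lambda>q. - kappa_deriv dx dxi q z * tt_val ?d ((coords h z)(q := mat_deriv (h q) (z q)))
      - kappa_quad dx dxi z * tt_val ?d ((coords h z)(q := mat_deriv (mat_deriv (h q)) (z q)))"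
  have c0: "channel_val dx dxi g s 0 z (?Y 0 (z s)) = (\<Sum>q\<in>{1..dx} - {s}. ?t q)"
    unfolding channel_val_def by (auto simp: ch hq intro!: sum.cong)
  show ?thesis
  proof (cases "s \<le> dx")
    case True
    then have "(\<Sum>q=1..dx. ?t q) = ?t s + (\<Sum>q\<in>{1..dx} - {s}. ?t q)"
      using s by (intro sum.remove) auto
    moreover have "?t s = channel_val dx dxi g s 1 z (?Y 1 (z s)) + channel_val dx dxi g s 2 z (?Y 2 (z s))"
      by (simp add: channel_val_def ch hs mat_deriv_param_core numeral_2_eq_2)
    ultimately show ?thesis using True unfolding darcy c0[symmetric] by (simp add: channels_def)
  next
    case False
    \<comment> \<open>A parametric slot is never differentiated, so channel 0 already contains every
      term.\<close>
    then have "{1..dx} - {s} = {1..dx}" by auto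
    then show ?thesis using False unfolding darcy by (simp add: channels_def c0)
  qed
qed

section \<open>Collocation\<close>

lemma lex_digits_less:
  "p < prod_list (map n ms) \<Longrightarrow> m \<in> set ms \<Longrightarrow> lex_digits n ms p m < n m"
proof (induction ms arbitrary: p)
  case (Cons k ms)
  let ?N = "prod_list (map n ms)"
  have "0 < ?N" using Cons.prems(1) by (cases "?N = 0") auto
  then have "p mod ?N < ?N" "p div ?N < n k"
    using Cons.prems(1) by (auto simp: less_mult_imp_div_less)
  then show ?case using Cons by auto
qed simp

text \<open>Block multiplication in which the lower blocks of the left factor have no rows and the
  right blocks of the right factor have no columns.\<close>

lemma append_cols_mult_append_rows:
  assumes "A \<in> carrier_mat N k" "B \<in> carrier_mat N k'" "C \<in> carrier_mat k p" "D \<in> carrier_mat k' p"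
  shows "append_cols A B * (C @\<^sub>r D) = A * C + B * D"
proof -
  have "append_cols A B * (C @\<^sub>r D) = four_block_mat (A * C + B * D) (A * 0\<^sub>m k 0 + B * 0\<^sub>m k' 0)
      (0\<^sub>m 0 k * C + 0\<^sub>m 0 k' * D) (0\<^sub>m 0 k * 0\<^sub>m k 0 + 0\<^sub>m 0 k' * 0\<^sub>m k' 0)"
    using assms unfolding append_cols_def append_rows_def
    by (subst mult_four_block_mat[of _ N k _ k' _ 0 _ _ p _ 0]) auto
  also have "\<dots> = A * C + B * D" using assms by (intro eq_matI) auto
  finally show ?thesis .
qed

lemma append_cols_carrier:
  "A \<in> carrier_mat N k \<Longrightarrow> B \<in> carrier_mat N k' \<Longrightarrow> append_cols A B \<in> carrier_mat N (k + k')"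
  by (rule carrier_matI) (auto simp: append_cols_def)

lemma Psi_quad_carrier: "Psi_quad dx dxi n r pt g s l \<in> carrier_mat (N_grid (dx+dxi) n) (n s * rank_prod r s)"
  by (simp add: Psi_quad_def)

lemma H_mat_carrier: "H_mat n r P pt G \<theta> s l \<in> carrier_mat (n s * rank_prod r s) (P s)"
  by (simp add: H_mat_def)

lemma Psi_quad_index:
  assumes dims: "1 \<le> dx" "1 \<le> dxi" and g: "core_train r (dx+dxi) g" and s: "s \<in> {1..dx+dxi}" and l: "l \<in> channels dx s"
    and "k < N_grid (dx+dxi) n" "c < n s * rank_prod r s"
  defines "i \<equiv> lex_digits n [1..<dx+dxi+1] k"
  shows "Psi_quad dx dxi n r pt g s l $$ (k, c) = (if i s = c div rank_prod r s
    then channel_val dx dxi g s l (\<lambda>m. pt m (i m)) (unit_mat r s (c mod rank_prod r s)) else 0)"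
  using assms(6,7) Q_P_Q_eq_channel_val[OF dims g s l, of "\<lambda>m. pt m (i m)" "c mod rank_prod r s"]
  by (auto simp: Psi_quad_def Let_def i_def)

text \<open>The Kronecker delta keeps only the columns of the grid index \<open>i s\<close>; the
  remaining sum over rank pairs is the expansion of the core in unit matrices.\<close>

lemma Psi_quad_mult_H_mat:
  assumes dims: "1 \<le> dx" "1 \<le> dxi" and g: "core_train r (dx+dxi) g" and s: "s \<in> {1..dx+dxi}" and l: "l \<in> channels dx s"
    and k: "k < N_grid (dx+dxi) n" and p: "p < P s"
  defines "i \<equiv> lex_digits n [1..<dx+dxi+1] k"
  assumes i: "i s < n s"
  shows "(Psi_quad dx dxi n r pt g s l * H_mat n r P pt G \<theta> s l) $$ (k, p)
    = channel_val dx dxi g s l (\<lambda>m. pt m (i m)) (param_core r P G \<theta> s p l (pt s (i s)))"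
proof -
  let ?R = "rank_prod r s" and ?z = "\<lambda>m. pt m (i m)"
  let ?c = "\<lambda>a. channel_val dx dxi g s l ?z (unit_mat r s a)"
    and ?D = "\<lambda>j a. (deriv ^^ l) (param_deriv_G P G \<theta> s p (a div r s, a mod r s)) (pt s j)"
  have "(Psi_quad dx dxi n r pt g s l * H_mat n r P pt G \<theta> s l) $$ (k, p)
     = (\<Sum>col<n s * ?R. Psi_quad dx dxi n r pt g s l $$ (k, col) * H_mat n r P pt G \<theta> s l $$ (col, p))"
    using k p by (simp add: scalar_prod_def Psi_quad_def H_mat_def lessThan_atLeast0)
  also have "\<dots> = (\<Sum>col<n s * ?R. if i s = col div ?R then ?c (col mod ?R) * ?D (col div ?R) (col mod ?R) else 0)"
    using Psi_quad_index[OF dims g s l k] p by (intro sum.cong refl) (auto simp: H_mat_def Let_def i_def)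
  also have "\<dots> = (\<Sum>j<n s. \<Sum>a<?R. if i s = j then ?c a * ?D j a else 0)"
    by (rule sum_div_mod[where f = "\<lambda>j a. if i s = j then ?c a * ?D j a else 0"])
  also have "\<dots> = (\<Sum>j<n s. if i s = j then \<Sum>a<?R. ?c a * ?D j a else 0)"
    by (intro sum.cong refl) simp
  also have "\<dots> = (\<Sum>a<?R. ?c a * ?D (i s) a)" using i by simp
  also have "\<dots> = (\<Sum>a<?R. ?c a * param_core r P G \<theta> s p l (pt s (i s)) $$ (a div r s, a mod r s))"
  proof (intro sum.cong refl)
    fix a assume "a \<in> {..<?R}"
    then have a: "a < r (s - 1) * r s" by (simp add: rank_prod_def)
    then have "0 < r s" by (cases "r s = 0") auto
    then show "?c a * ?D (i s) a = ?c a * param_core r P G \<theta> s p l (pt s (i s)) $$ (a div r s, a mod r s)"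
      using less_mult_imp_div_less[OF a] by (simp add: param_core_index)
  qed
  also have "\<dots> = channel_val dx dxi g s l ?z (param_core r P G \<theta> s p l (pt s (i s)))"
    by (rule channel_val_expansion[OF g s param_core_carrier])
  finally show ?thesis .
qed

lemma Psi_quad_all_carrier:
  "Psi_quad_all dx dxi n r pt g s \<in> carrier_mat (N_grid (dx+dxi) n) ((if s \<le> dx then 3 else 1) * (n s * rank_prod r s))"
proof (cases "s \<le> dx")
  case True
  let ?k = "n s * rank_prod r s"
  have "Psi_quad_all dx dxi n r pt g s \<in> carrier_mat (N_grid (dx+dxi) n) (?k + (?k + ?k))"
    using True unfolding Psi_quad_all_def by (simp add: append_cols_carrier Psi_quad_carrier)
  moreover have "?k + (?k + ?k) = 3 * ?k" by simp
  ultimately show ?thesis using True by (simp only: if_True)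
qed (simp add: Psi_quad_all_def Psi_quad_carrier)

theorem proposition5p7:
  fixes dx dxi :: nat
    and H :: "nat \<Rightarrow> 'h::{real_inner,complete_space} set"
    and rep :: "nat \<Rightarrow> 'h \<Rightarrow> real \<Rightarrow> real"
    and repV :: "'v::{real_inner,complete_space,second_countable_topology} \<Rightarrow> (nat \<Rightarrow> real) \<Rightarrow> real"
    and r n P :: "nat \<Rightarrow> nat"
    and G :: "nat \<Rightarrow> real vec \<Rightarrow> real \<Rightarrow> real mat"
    and \<theta> :: "nat \<Rightarrow> real vec"
    and pt :: "nat \<Rightarrow> nat \<Rightarrow> real"
    and \<kappa> :: "qterm \<Rightarrow> nat \<Rightarrow> real \<Rightarrow> real"
  defines "d \<equiv> dx + dxi" and "g \<equiv> \<lambda>m. G m (\<theta> m)"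
  assumes dims: "1 \<le> dx" "1 \<le> dxi"
    and sizes: "\<forall>m\<le>d. 1 \<le> r m" "\<forall>m\<in>{1..d}. 1 \<le> n m"
    and spaces: "space_setting dx dxi H rep repV"
    and ansatz: "tt_ansatz dx dxi r P H rep G"
    and parameter: "\<forall>m\<in>{1..d}. \<theta> m \<in> carrier_vec (P m)"
    and grid: "\<forall>m\<in>{1..d}. \<forall>i<n m. pt m i \<in> Dom dx m"
    and factors: "separable_factors dx dxi \<kappa>"
  shows "(\<forall>s\<in>{1..d}. \<forall>l\<in>channels dx s.
            Psi_channel dx dxi n r pt g \<kappa> s l = Psi_quad dx dxi n r pt g s l)
       \<and> (\<forall>s\<in>{1..d}.
            Jac dx dxi n P pt G \<theta> s = Psi_quad_all dx dxi n r pt g s * C_channel dx n r P pt G \<theta> s)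
       \<and> N_eff dx dxi n r pt g
            = 3 * (\<Sum>s=1..dx. n s * r (s-1) * r s) + (\<Sum>s=dx+1..d. n s * r (s-1) * r s)"
proof (intro conjI ballI)
  have g: "core_train r (dx+dxi) g"
    using ansatz parameter by (auto simp: core_train_def tt_ansatz_def g_def d_def)
  have digits: "lex_digits n [1..<dx+dxi+1] row m < n m" if "row < N_grid (dx+dxi) n" "m \<in> {1..dx+dxi}" for row m
  proof (rule lex_digits_less)
    show "row < prod_list (map n [1..<dx+dxi+1])" using that(1) unfolding prod_list_upto N_grid_def .
  qed (use that in auto)
  \<comment> \<open>The collocation points lie in the open box, where the factorization and the
    two-sided derivatives are available.\<close>
  have box: "in_box dx (dx+dxi) (\<lambda>m. pt m (lex_digits n [1..<dx+dxi+1] row m))" if "row < N_grid (dx+dxi) n" for row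
    using grid digits[OF that] by (simp add: in_box_def d_def)
  {
    fix s l assume s: "s \<in> {1..d}" and l: "l \<in> channels dx s"
    have s': "s \<in> {1..dx+dxi}" using s by (simp add: d_def)
    show "Psi_channel dx dxi n r pt g \<kappa> s l = Psi_quad dx dxi n r pt g s l"
    proof (rule eq_matI)
      fix row col assume "row < dim_row (Psi_quad dx dxi n r pt g s l)" "col < dim_col (Psi_quad dx dxi n r pt g s l)"
      then have row: "row < N_grid (dx+dxi) n" and col: "col < n s * rank_prod r s"
        by (simp_all add: Psi_quad_def)
      \<comment> \<open>The existence of a column excludes an empty set of rank pairs, so the
        remainder encodes a valid pair.\<close>
      have "0 < rank_prod r s" using col by (cases "rank_prod r s = 0") auto
      then have a: "col mod rank_prod r s < rank_prod r s" by simp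
      let ?i = "lex_digits n [1..<dx+dxi+1] row"
      have "Psi_channel dx dxi n r pt g \<kappa> s l $$ (row, col) = (if ?i s = col div rank_prod r s then
          (\<Sum>(\<tau>, q)\<in>qterms dxi \<times> {1..dx}. channel_coeff dx \<kappa> s l \<tau> q (pt s (?i s))
            * E_mat (dx+dxi) n r pt g \<kappa> s \<tau> q $$ (lex_pos n (others (dx+dxi) s) ?i, col mod rank_prod r s)) else 0)"
        using row col by (auto simp: Psi_channel_def Let_def simp del: upt_Suc)
      moreover have "E_mat (dx+dxi) n r pt g \<kappa> s \<tau> q $$ (lex_pos n (others (dx+dxi) s) ?i, col mod rank_prod r s)
          = tt_val (dx+dxi) ((\<lambda>m. op_factor_mat \<kappa> \<tau> q m (g m) (pt m (?i m)))(s := unit_mat r s (col mod rank_prod r s)))" for \<tau> q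
        by (rule E_mat_index[OF g s' digits[OF row] a])
      ultimately show "Psi_channel dx dxi n r pt g \<kappa> s l $$ (row, col) = Psi_quad dx dxi n r pt g s l $$ (row, col)"
        unfolding Psi_quad_index[OF dims g s' l row col]
          sum_E_mat_eq_channel_val[OF dims g s' l unit_mat_carrier factors box[OF row], symmetric] by (simp del: upt_Suc)
    qed (simp_all add: Psi_channel_def Psi_quad_def)
  }
  {
    fix s assume s: "s \<in> {1..d}"
    have s': "s \<in> {1..dx+dxi}" using s by (simp add: d_def)
    let ?\<Psi> = "Psi_quad dx dxi n r pt g s" and ?H = "H_mat n r P pt G \<theta> s"
    let ?N = "N_grid (dx+dxi) n" and ?k = "n s * rank_prod r s"
    have Pc: "?\<Psi> l \<in> carrier_mat ?N ?k" and Hc: "?H l \<in> carrier_mat ?k (P s)" for l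
      by (rule Psi_quad_carrier H_mat_carrier)+
    have prod: "Psi_quad_all dx dxi n r pt g s * C_channel dx n r P pt G \<theta> s
      = (if s \<le> dx then ?\<Psi> 0 * ?H 0 + (?\<Psi> 1 * ?H 1 + ?\<Psi> 2 * ?H 2) else ?\<Psi> 0 * ?H 0)"
    proof -
      have "append_cols (?\<Psi> 0) (append_cols (?\<Psi> 1) (?\<Psi> 2)) * (?H 0 @\<^sub>r (?H 1 @\<^sub>r ?H 2))
        = ?\<Psi> 0 * ?H 0 + (append_cols (?\<Psi> 1) (?\<Psi> 2)) * (?H 1 @\<^sub>r ?H 2)"
        by (rule append_cols_mult_append_rows[OF Pc append_cols_carrier[OF Pc Pc] Hc carrier_append_rows[OF Hc Hc]])
      also have "(append_cols (?\<Psi> 1) (?\<Psi> 2)) * (?H 1 @\<^sub>r ?H 2) = ?\<Psi> 1 * ?H 1 + ?\<Psi> 2 * ?H 2"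
        by (rule append_cols_mult_append_rows[OF Pc Pc Hc Hc])
      finally show ?thesis by (simp add: Psi_quad_all_def C_channel_def)
    qed
    have car: "?\<Psi> l * ?H l \<in> carrier_mat ?N (P s)" for l
      by (rule mult_carrier_mat[OF Pc Hc])
    have car': "Psi_quad_all dx dxi n r pt g s * C_channel dx n r P pt G \<theta> s \<in> carrier_mat ?N (P s)"
      using car by (auto simp: prod intro!: add_carrier_mat)
    show "Jac dx dxi n P pt G \<theta> s = Psi_quad_all dx dxi n r pt g s * C_channel dx n r P pt G \<theta> s"
    proof (rule eq_matI)
      fix row p assume "row < dim_row (Psi_quad_all dx dxi n r pt g s * C_channel dx n r P pt G \<theta> s)"
        "p < dim_col (Psi_quad_all dx dxi n r pt g s * C_channel dx n r P pt G \<theta> s)"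
      then have row: "row < ?N" and p: "p < P s" using carrier_matD[OF car'] by simp_all
      let ?z = "\<lambda>m. pt m (lex_digits n [1..<dx+dxi+1] row m)"
      have "Jac dx dxi n P pt G \<theta> s $$ (row, p) = darcy dx dxi (param_deriv_u (dx+dxi) P G \<theta> s p) ?z"
        using row p by (simp add: Jac_def del: upt_Suc)
      also have "\<dots> = (\<Sum>l\<in>channels dx s. channel_val dx dxi g s l ?z (param_core r P G \<theta> s p l (?z s)))"
        unfolding g_def using parameter
        by (intro darcy_param_deriv_u[OF dims ansatz _ s' p box[OF row]]) (simp add: d_def)
      also have "\<dots> = (\<Sum>l\<in>channels dx s. (?\<Psi> l * ?H l) $$ (row, p))"
      proof (rule sum.cong[OF refl])
        fix l assume l: "l \<in> channels dx s"
        show "channel_val dx dxi g s l ?z (param_core r P G \<theta> s p l (?z s)) = (?\<Psi> l * ?H l) $$ (row, p)"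
          by (rule Psi_quad_mult_H_mat[where k = row and P = P, OF dims g s' l row p digits[OF row s'], symmetric])
      qed
      also have "\<dots> = (Psi_quad_all dx dxi n r pt g s * C_channel dx n r P pt G \<theta> s) $$ (row, p)"
        using row p carrier_matD[OF Pc] carrier_matD[OF Hc] unfolding prod by (auto simp: channels_def simp del: index_mult_mat(1))
      finally show "Jac dx dxi n P pt G \<theta> s $$ (row, p) = (Psi_quad_all dx dxi n r pt g s * C_channel dx n r P pt G \<theta> s) $$ (row, p)" .
    qed (use carrier_matD[OF car'] in \<open>simp_all add: Jac_def\<close>)
  }
  have "N_eff dx dxi n r pt g = (\<Sum>s=1..dx+dxi. (if s \<le> dx then 3 else 1) * (n s * rank_prod r s))"
    unfolding N_eff_def using Psi_quad_all_carrier by (intro sum.cong refl) (rule carrier_matD(2))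
  also have "\<dots> = (\<Sum>s=1..dx. 3 * (n s * rank_prod r s)) + (\<Sum>s=dx+1..dx+dxi. n s * rank_prod r s)"
  proof -
    have "{1..dx+dxi} = {1..dx} \<union> {dx+1..dx+dxi}" by auto
    then have "(\<Sum>s=1..dx+dxi. (if s \<le> dx then 3 else 1) * (n s * rank_prod r s))
      = (\<Sum>s=1..dx. (if s \<le> dx then 3 else 1) * (n s * rank_prod r s))
        + (\<Sum>s=dx+1..dx+dxi. (if s \<le> dx then 3 else 1) * (n s * rank_prod r s))"
      by (simp only:) (rule sum.union_disjoint, auto)
    then show ?thesis by simp
  qed
  finally show "N_eff dx dxi n r pt g
            = 3 * (\<Sum>s=1..dx. n s * r (s-1) * r s) + (\<Sum>s=dx+1..d. n s * r (s-1) * r s)"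
    by (simp add: sum_distrib_left rank_prod_def d_def mult.assoc)
qed

end
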